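(* Let $b\geqslant2$ be an integer, let $\alpha_1,\alpha_2>0$ and let $y\in\mathbb{R}$. Set $$K_{\alpha_1,\alpha_2}(y)=\left(\left[0,\frac{\alpha_1}{\Delta^b(y)}\right]\times\left[0,\frac{\alpha_2}{\Delta^b(y)}\right]\right)\cup\left\{(H_1,H_2):\ H_1\in[0,\alpha_1]\ \text{and}\ H_2=\frac{\alpha_2}{\alpha_1}H_1\right\}.$$ Then for any $(H_1,H_2)\in\big([0,\alpha_1]\times[0,\alpha_2]\big)\setminus K_{\alpha_1,\alpha_2}(y)$, the bivariate multifractal spectrum of the Lévy function $L_{\alpha_1}^b$ and the translated Lévy function $L_{\alpha_2}^{b,y}$ satisfies either $$\mathcal{D}_{L_{\alpha_1}^b,L_{\alpha_2}^{b,y}}(H_1,H_2)=\min\left\{\frac{H_1}{\alpha_1},\frac{H_2}{\alpha_2}\right\}$$ or $$\mathcal{D}_{L_{\alpha_1}^b,L_{\alpha_2}^{b,y}}(H_1,H_2)=-\infty.$$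
   Context: Saw-tooth function: $\{x\}=x-\lfloor x\rfloor-\tfrac12$ if $x\notin\mathbb{Z}$ and $\{x\}=0$ if $x\in\mathbb{Z}$. For $\alpha>0$, an integer $b\geqslant2$ and $y\in\mathbb{R}$, the Lévy function and the translated Lévy function are, for $x\in\mathbb{R}$, $$L_\alpha^b(x)=\sum_{i=1}^\infty\frac{\{b^ix\}}{b^{\alpha i}},\qquad L_\alpha^{b,y}(x)=\sum_{i=1}^\infty\frac{\{b^i(x-y)\}}{b^{\alpha i}}=L_\alpha^b(x-y).$$ Hölder exponent: for a locally bounded $f:\mathbb{R}\to\mathbb{R}$, $\alpha>0$ and $x_0\in\mathbb{R}$, $f\in C^\alpha(x_0)$ if there exist $C>0$, $r>0$ and a polynomial $P$ with $\deg P<\alpha$ such that $|f(x)-P(x-x_0)|\leqslant C|x-x_0|^\alpha$ for all $x\in[x_0-r,x_0+r]$. The Hölder exponent is $h_f(x_0)=\sup\{\alpha\geqslant0: f\in C^\alpha(x_0)\}$ (equal to $0$ if $f\in C^\alpha(x_0)$ for no $\alpha>0$). Bivariate multifractal spectrum: for functions $f,g$ and reals $H_1,H_2$, $\mathcal{D}_{f,g}(H_1,H_2)=\dim_H\{x\in\mathbb{R}: h_f(x)=H_1,\ h_g(x)=H_2\}$, where $\dim_H$ is the Hausdorff dimension, with the convention $\dim_H(\emptyset)=-\infty$. $b$-adic approximation exponent: for $x\in\mathbb{R}$, $$\Delta^b(x)=\sup\left\{\alpha\geqslant1:\ \|b^nx\|\leqslant b^{-n(\alpha-1)}\ \text{for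 infinitely many } n\in\mathbb{N}\right\}\in[1,+\infty],$$ where $\|\cdot\|$ denotes the distance to the nearest integer. If $\Delta^b(y)=+\infty$, then $\alpha_i/\Delta^b(y)$ is understood as $0$. *)

theory Defs
  imports "HOL-Analysis.Analysis" "HOL-Computational_Algebra.Polynomial"
begin

section \<open>Levy functions\<close>

definition sawtooth :: "real \<Rightarrow> real" where
  "sawtooth x = (if x \<in> \<int> then 0 else x - of_int \<lfloor>x\<rfloor> - 1 / 2)"

text \<open>The series run over \<open>i \<ge> 1\<close>, hence the index \<open>Suc i\<close>. They converge absolutely for
  \<open>\<alpha> > 0\<close> and \<open>b \<ge> 2\<close>, because the saw-tooth function is bounded.\<close>

definition levy :: "real \<Rightarrow> nat \<Rightarrow> real \<Rightarrow> real" where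
  "levy \<alpha> b x = (\<Sum>i. sawtooth (real b ^ Suc i * x) / real b powr (\<alpha> * real (Suc i)))"

definition levy_translated :: "real \<Rightarrow> nat \<Rightarrow> real \<Rightarrow> real \<Rightarrow> real" where
  "levy_translated \<alpha> b y x =
     (\<Sum>i. sawtooth (real b ^ Suc i * (x - y)) / real b powr (\<alpha> * real (Suc i)))"

section \<open>Pointwise Hoelder regularity\<close>

text \<open>Intended for \<open>\<alpha> > 0\<close>. Since \<open>0 powr \<alpha> = 0\<close>, the inequality at \<open>x = x\<^sub>0\<close> forces
  \<open>f x\<^sub>0 = poly P 0\<close>, as it should.\<close>

definition holder_at :: "real \<Rightarrow> (real \<Rightarrow> real) \<Rightarrow> real \<Rightarrow> bool" where
  "holder_at \<alpha> f x\<^sub>0 \<longleftrightarrow>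
     (\<exists>C > 0. \<exists>r > 0. \<exists>P :: real poly. real (degree P) < \<alpha> \<and>
        (\<forall>x \<in> {x\<^sub>0 - r..x\<^sub>0 + r}. \<bar>f x - poly P (x - x\<^sub>0)\<bar> \<le> C * \<bar>x - x\<^sub>0\<bar> powr \<alpha>))"

text \<open>The exponent may be infinite; inserting \<open>0\<close> implements the convention that it is \<open>0\<close> when
  \<open>f\<close> satisfies the condition for no \<open>\<alpha> > 0\<close>.\<close>

definition holder_exponent :: "(real \<Rightarrow> real) \<Rightarrow> real \<Rightarrow> ereal" where
  "holder_exponent f x\<^sub>0 = Sup (insert 0 (ereal ` {\<alpha>. \<alpha> > 0 \<and> holder_at \<alpha> f x\<^sub>0}))"

section \<open>Hausdorff dimension\<close>

text \<open>The term \<open>(diam U)\<^sup>s\<close>, with the usual conventions \<open>(diam {})\<^sup>s = 0\<close> for all \<open>s \<ge> 0\<close> and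
  \<open>0\<^sup>0 = 1\<close> for nonempty sets (\<open>powr\<close> would give \<open>0\<close>).\<close>

definition diameter_powr :: "real \<Rightarrow> 'a::metric_space set \<Rightarrow> real" where
  "diameter_powr s U = (if U = {} then 0 else if s = 0 then 1 else diameter U powr s)"

text \<open>Countable covers are indexed by \<^typ>\<open>nat\<close>; finite ones are padded with empty sets.
  Boundedness is explicit because \<^const>\<open>diameter\<close> is only meaningful for bounded sets.\<close>

definition hausdorff_premeasure :: "real \<Rightarrow> real \<Rightarrow> 'a::metric_space set \<Rightarrow> ennreal" where
  "hausdorff_premeasure s \<delta> E =
     (INF U \<in> {U :: nat \<Rightarrow> 'a set. E \<subseteq> (\<Union>i. U i) \<and> (\<forall>i. bounded (U i) \<and> diameter (U i) \<le> \<delta>)}.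
        \<Sum>i. ennreal (diameter_powr s (U i)))"

definition hausdorff_measure :: "real \<Rightarrow> 'a::metric_space set \<Rightarrow> ennreal" where
  "hausdorff_measure s E = (SUP \<delta> \<in> {0<..}. hausdorff_premeasure s \<delta> E)"

definition hausdorff_dim :: "'a::metric_space set \<Rightarrow> ereal" where
  "hausdorff_dim E =
     (if E = {} then - \<infinity> else Inf (ereal ` {s. s \<ge> 0 \<and> hausdorff_measure s E = 0}))"

definition bivariate_spectrum ::
    "(real \<Rightarrow> real) \<Rightarrow> (real \<Rightarrow> real) \<Rightarrow> real \<Rightarrow> real \<Rightarrow> ereal" where
  "bivariate_spectrum f g H\<^sub>1 H\<^sub>2 =
     hausdorff_dim {x. holder_exponent f x = ereal H\<^sub>1 \<and> holder_exponent g x = ereal H\<^sub>2}"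

section \<open>Approximation by b-adic numbers\<close>

definition dist_nearest_int :: "real \<Rightarrow> real" where
  "dist_nearest_int x = infdist x \<int>"

definition adic_exponent :: "nat \<Rightarrow> real \<Rightarrow> ereal" where
  "adic_exponent b x =
     Sup (ereal ` {\<alpha>. \<alpha> \<ge> 1 \<and>
       (\<exists>\<^sub>\<infinity>n. dist_nearest_int (real b ^ n * x) \<le> real b powr (- (real n * (\<alpha> - 1))))})"

text \<open>In \<^typ>\<open>ereal\<close>, \<open>\<alpha> / \<infinity> = 0\<close> for real \<open>\<alpha>\<close>, as required when the exponent of \<open>y\<close> is infinite.\<close>

definition K_set :: "nat \<Rightarrow> real \<Rightarrow> real \<Rightarrow> real \<Rightarrow> (real \<times> real) set" where
  "K_set b \<alpha>\<^sub>1 \<alpha>\<^sub>2 y =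
     ({H\<^sub>1. 0 \<le> H\<^sub>1 \<and> ereal H\<^sub>1 \<le> ereal \<alpha>\<^sub>1 / adic_exponent b y} \<times>
      {H\<^sub>2. 0 \<le> H\<^sub>2 \<and> ereal H\<^sub>2 \<le> ereal \<alpha>\<^sub>2 / adic_exponent b y})
     \<union> {(H\<^sub>1, H\<^sub>2). H\<^sub>1 \<in> {0..\<alpha>\<^sub>1} \<and> H\<^sub>2 = \<alpha>\<^sub>2 / \<alpha>\<^sub>1 * H\<^sub>1}"

end

theory Submission
  imports Defs
begin

text \<open>The Levy function has Hoelder exponent \<open>\<alpha> / \<Delta>(x)\<close> at \<open>x\<close>, so the level set in question consists
  of the points \<open>x\<close> with prescribed approximation exponents \<open>\<delta>\<^sub>1 = \<Delta>(x)\<close> and \<open>\<delta>\<^sub>2 = \<Delta>(x - y)\<close>. These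
  differ off the diagonal; say \<open>\<delta>\<^sub>1 < \<delta>\<^sub>2\<close>. The natural cover by \<open>b\<close>-adic balls around the
  points \<open>y + p / b\<^sup>n\<close> bounds the dimension by \<open>1 / \<delta>\<^sub>2\<close>. Conversely, suppose that there is a point \<open>x\<^sub>0\<close> of the
  level set. At the scales where \<open>x\<^sub>0 - y\<close> is well approximated, \<open>y\<close> looks like \<open>x\<^sub>0\<close>, hence is approximated
  with exponent at most \<open>\<delta>\<^sub>1\<close>. A Cantor set whose points follow \<open>y\<close> on a sparse sequence
  of these scales, follow a \<open>b\<close>-adic number on another one, and otherwise keep
  away from both grids, is therefore contained in the level set, and its dimension is
  arbitrarily close to \<open>1 / \<delta>\<^sub>2\<close>.\<close>

section \<open>Distance to the nearest integer and approximation exponents\<close>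

text \<open>The dichotomy arises because it is never decided when the level set is empty: one point
  \<open>x\<^sub>0\<close> certifies all that the construction needs. Write u and v for the two
  translates, v having the larger exponent. In a block where a constructed point x follows v, x - u
  is \<open>x\<^sub>0\<close> - u plus (x - v) - (\<open>x\<^sub>0\<close> - v). After scaling, both
  brackets are nearly integers, so x - u is approximated no better than \<open>x\<^sub>0\<close> -
  u. This is available only at scales where \<open>x\<^sub>0\<close> - v is itself that close to its
  grid. Long blocks can thus not be placed at will; the schedule has to wait for these scales, which
  may be very sparse. The proportion of free digits is worst at the end of a long block, about 1 /
  \<open>\<delta>\<^sub>2\<close>, which is the dimension. A fixed number of levels per step is lost
  to avoiding both grids; long steps make this loss negligible. If the larger exponent is infinite,
  the dimension is 0 and the cover alone is needed.\<close>

abbreviation nd :: "real \<Rightarrow> real" where "nd \<equiv> dist_nearest_int"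

lemma nd_nonneg [simp]: "0 \<le> nd x"
  by (simp add: dist_nearest_int_def infdist_nonneg)

lemma nd_le: "nd x \<le> \<bar>x - of_int p\<bar>"
  unfolding dist_nearest_int_def by (metis Ints_of_int dist_real_def infdist_le)

lemma nd_attained: obtains p :: int where "nd x = \<bar>x - of_int p\<bar>"
proof -
  obtain y where "y \<in> \<int>" "infdist x \<int> = dist x y"
    using infdist_attains_inf[of "\<int> :: real set" x] closed_Ints Ints_0 by blast
  then show ?thesis
    using that by (auto simp: dist_nearest_int_def dist_real_def elim!: Ints_cases)
qed

lemma nd_le_half: "nd x \<le> 1 / 2"
  using nd_le[of x "round x"] of_int_round_abs_le[of x] by (simp add: abs_minus_commute)

lemma nd_add: "nd (x + y) \<le> nd x + nd y"
proof -
  obtain p q where "nd x = \<bar>x - of_int p\<bar>" "nd y = \<bar>y - of_int q\<bar>"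
    by (metis nd_attained)
  then show ?thesis
    using nd_le[of "x + y" "p + q"] by simp
qed

lemma nd_minus [simp]: "nd (- x) = nd x"
proof -
  have "nd (- x) \<le> nd x" for x
  proof -
    obtain p where "nd x = \<bar>x - of_int p\<bar>" by (metis nd_attained)
    then show ?thesis using nd_le[of "- x" "- p"] by simp
  qed
  from this[of x] this[of "- x"] show ?thesis by simp
qed

lemma nd_diff: "nd (x - y) \<le> nd x + nd y"
  using nd_add[of x "- y"] by simp

lemma nd_mult_nat: "nd (real k * x) \<le> real k * nd x"
proof -
  obtain p where p: "nd x = \<bar>x - of_int p\<bar>" by (metis nd_attained)
  have "nd (real k * x) \<le> \<bar>real k * x - of_int (int k * p)\<bar>" by (rule nd_le)
  also have "\<dots> = \<bar>real k * (x - of_int p)\<bar>" by (simp add: algebra_simps)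
  also have "\<dots> = real k * nd x" by (simp add: abs_mult p)
  finally show ?thesis .
qed

locale adic_base =
  fixes b :: nat
  assumes b_ge_2: "2 \<le> b"
begin

abbreviation \<Delta> :: "real \<Rightarrow> ereal" where "\<Delta> \<equiv> adic_exponent b"

lemma real_b: "real b > 1" "real b > 0" "real b \<noteq> 0" "real b \<noteq> 1" "real b \<ge> 2"
  using b_ge_2 by auto

text \<open>One multiplication by \<open>b\<close> stretches the distance to the integers by at most
  \<open>b\<close>. Read forwards, this carries smallness to later levels; read backwards, it
  carries a lower bound to earlier levels.\<close>

lemma nd_power_le: "m \<le> n \<Longrightarrow> nd (real b ^ n * z) \<le> real b powr (real n - real m) * nd (real b ^ m * z)"
proof -
  assume mn: "m \<le> n"
  have "nd (real b ^ n * z) = nd (real (b ^ (n - m)) * (real b ^ m * z))"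
    using mn by (simp add: power_add[symmetric] mult.assoc[symmetric])
  also have "\<dots> \<le> real (b ^ (n - m)) * nd (real b ^ m * z)"
    by (rule nd_mult_nat)
  also have "real (b ^ (n - m)) = real b powr (real n - real m)"
    using mn real_b by (simp add: powr_realpow[symmetric] of_nat_diff)
  finally show ?thesis .
qed

lemma adic_exponent_ge_1: "1 \<le> \<Delta> z"
proof -
  have "nd (real b ^ n * z) \<le> real b powr - (real n * (1 - 1))" for n
    using nd_le_half[of "real b ^ n * z"] real_b by simp
  then show ?thesis
    unfolding adic_exponent_def by (intro Sup_upper) (auto simp: one_ereal_def)
qed

lemma adic_exponent_gtD:
  assumes "ereal \<delta> < \<Delta> z"
  shows "\<exists>\<^sub>\<infinity>n. nd (real b ^ n * z) \<le> real b powr - (real n * (\<delta> - 1))"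
proof -
  obtain \<alpha> where "\<delta> < \<alpha>"
    and inf: "\<exists>\<^sub>\<infinity>n. nd (real b ^ n * z) \<le> real b powr - (real n * (\<alpha> - 1))"
    using assms unfolding adic_exponent_def less_Sup_iff by auto
  show ?thesis
  proof (rule INFM_mono[OF inf])
    fix n assume "nd (real b ^ n * z) \<le> real b powr - (real n * (\<alpha> - 1))"
    also have "\<dots> \<le> real b powr - (real n * (\<delta> - 1))"
      using \<open>\<delta> < \<alpha>\<close> real_b by (intro powr_mono) (auto intro: mult_left_mono)
    finally show "nd (real b ^ n * z) \<le> real b powr - (real n * (\<delta> - 1))" .
  qed
qed

lemma adic_exponent_lessD:
  assumes "\<Delta> z < ereal \<delta>"
  obtains N where "\<And>n. N \<le> n \<Longrightarrow> real b powr - (real n * (\<delta> - 1)) < nd (real b ^ n * z)"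
proof -
  have "1 \<le> \<delta>" using adic_exponent_ge_1[of z] assms
    by (metis ereal_less_eq(3) less_imp_le one_ereal_def order_trans)
  have "\<not> (\<exists>\<^sub>\<infinity>n. nd (real b ^ n * z) \<le> real b powr - (real n * (\<delta> - 1)))"
  proof
    assume "\<exists>\<^sub>\<infinity>n. nd (real b ^ n * z) \<le> real b powr - (real n * (\<delta> - 1))"
    with \<open>1 \<le> \<delta>\<close> have "ereal \<delta> \<le> \<Delta> z"
      unfolding adic_exponent_def by (intro Sup_upper) auto
    with assms show False by simp
  qed
  then show ?thesis
    using that unfolding INFM_nat_le by (meson not_le)
qed

lemma adic_exponent_geI:
  assumes "\<And>\<epsilon>. \<epsilon> > 0 \<Longrightarrow> \<exists>\<^sub>\<infinity>n. nd (real b ^ n * z) \<le> real b powr - (real n * (\<delta> - \<epsilon> - 1))"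
  shows "ereal \<delta> \<le> \<Delta> z"
proof (rule dense_le)
  fix e assume "e < ereal \<delta>"
  show "e \<le> \<Delta> z"
  proof (cases e)
    case (real r)
    show ?thesis
    proof (cases "r \<le> 1")
      case True
      then have "e \<le> 1" using real by (simp add: one_ereal_def)
      then show ?thesis using adic_exponent_ge_1 order_trans by blast
    next
      case False
      have "\<exists>\<^sub>\<infinity>n. nd (real b ^ n * z) \<le> real b powr - (real n * (r - 1))"
        using assms[of "\<delta> - r"] \<open>e < ereal \<delta>\<close> real by simp
      with False show ?thesis
        unfolding adic_exponent_def real by (intro Sup_upper) auto
    qed
  qed (use \<open>e < ereal \<delta>\<close> in auto)
qed

text \<open>A lower bound at one level of each window is enough: a very good approximation at level
  \<open>n\<close> stays good throughout \<open>{n..n + k}\<close>, up to a factor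
  \<open>b^k\<close>, and bounded factors are absorbed by \<epsilon>. The windows make it possible
  to skip free digits, whose levels are not controlled directly.\<close>

lemma adic_exponent_leI:
  assumes "1 \<le> \<delta>"
    and bound: "\<And>\<epsilon>. \<epsilon> > 0 \<Longrightarrow> \<exists>c>0. \<exists>k N. \<forall>n\<ge>N. \<exists>n'\<in>{n..n + k}.
      c * real b powr - (real n' * (\<delta> + \<epsilon> - 1)) \<le> nd (real b ^ n' * z)"
  shows "\<Delta> z \<le> ereal \<delta>"
proof (rule ccontr)
  assume "\<not> \<Delta> z \<le> ereal \<delta>"
  then obtain \<alpha> where "ereal \<delta> < ereal \<alpha>" "ereal \<alpha> < \<Delta> z"
    by (metis ereal_dense2 not_le)
  then have "\<delta> < \<alpha>" by simp
  \<comment> \<open>Half of the excess enters the assumed bound; the other half gives the decay in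
    \<open>n\<close> that beats the constants.\<close>
  define \<epsilon> where "\<epsilon> = (\<alpha> - \<delta>) / 2"
  have "\<epsilon> > 0" and \<alpha>: "\<alpha> = \<delta> + \<epsilon> + \<epsilon>" using \<open>\<delta> < \<alpha>\<close> by (auto simp: \<epsilon>_def field_simps)
  obtain c k N where "c > 0" and c: "\<And>n. n \<ge> N \<Longrightarrow> \<exists>n'\<in>{n..n + k}.
      c * real b powr - (real n' * (\<delta> + \<epsilon> - 1)) \<le> nd (real b ^ n' * z)"
    using bound[OF \<open>\<epsilon> > 0\<close>] by blast
  \<comment> \<open>What remains of \<open>c\<close> when the estimate at \<open>n'\<close> is moved
    back to \<open>n\<close>, given \<open>n' \<le> n + k\<close>.\<close>
  define c' where "c' = c * real b powr - (real k * (\<delta> + \<epsilon>))"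
  have "c' > 0" using \<open>c > 0\<close> real_b by (simp add: c'_def)
  have "(\<lambda>n. (real b powr - \<epsilon>) ^ n) \<longlonglongrightarrow> 0"
    using real_b \<open>\<epsilon> > 0\<close> by (intro LIMSEQ_realpow_zero) (auto simp: powr_less_one)
  then have "\<forall>\<^sub>F n in sequentially. (real b powr - \<epsilon>) ^ n < c'"
    using \<open>c' > 0\<close> order_tendstoD(2) by blast
  then obtain N' where N': "\<And>n. n \<ge> N' \<Longrightarrow> (real b powr - \<epsilon>) ^ n < c'"
    by (auto simp: eventually_sequentially)
  from adic_exponent_gtD[OF \<open>ereal \<alpha> < \<Delta> z\<close>]
  obtain n where n: "max N N' \<le> n" "nd (real b ^ n * z) \<le> real b powr - (real n * (\<alpha> - 1))"
    unfolding INFM_nat_le by blast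
  obtain n' where n': "n \<le> n'" "n' \<le> n + k"
      "c * real b powr - (real n' * (\<delta> + \<epsilon> - 1)) \<le> nd (real b ^ n' * z)"
    using c[of n] n by auto
  note n'(3)
  also have "nd (real b ^ n' * z) \<le> real b powr (real n' - real n) * nd (real b ^ n * z)"
    using n' by (intro nd_power_le)
  also have "\<dots> \<le> real b powr (real n' - real n) * real b powr - (real n * (\<alpha> - 1))"
    using n(2) by (intro mult_left_mono) auto
  also have "\<dots> = real b powr (real n' - real n * \<alpha>)"
    by (simp add: powr_add[symmetric] algebra_simps)
  finally have "c * real b powr - (real n' * (\<delta> + \<epsilon> - 1)) * real b powr (real n' * (\<delta> + \<epsilon> - 1))
      \<le> real b powr (real n' - real n * \<alpha>) * real b powr (real n' * (\<delta> + \<epsilon> - 1))"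
    by (intro mult_right_mono) auto
  then have "c \<le> real b powr (real n' * (\<delta> + \<epsilon>) - real n * \<alpha>)"
    using real_b by (simp add: powr_add[symmetric] mult.assoc algebra_simps)
  also have "\<dots> \<le> real b powr ((real n + real k) * (\<delta> + \<epsilon>) - real n * \<alpha>)"
    using n' \<open>1 \<le> \<delta>\<close> \<open>\<epsilon> > 0\<close> real_b
    by (intro powr_mono diff_right_mono mult_right_mono) auto
  also have "(real n + real k) * (\<delta> + \<epsilon>) - real n * \<alpha> = real k * (\<delta> + \<epsilon>) - \<epsilon> * real n"
    unfolding \<alpha> by (simp add: algebra_simps)
  finally have "c * real b powr - (real k * (\<delta> + \<epsilon>))
      \<le> real b powr (real k * (\<delta> + \<epsilon>) - \<epsilon> * real n) * real b powr - (real k * (\<delta> + \<epsilon>))"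
    by (intro mult_right_mono) auto
  then have "c' \<le> real b powr (- \<epsilon> * real n)"
    by (simp add: c'_def powr_add[symmetric])
  also have "\<dots> = (real b powr - \<epsilon>) ^ n"
    using real_b by (simp add: powr_power mult.commute)
  finally show False using N'[of n] n(1) by simp
qed

end

section \<open>The Hoelder exponent of the Levy function\<close>

lemma sawtooth_bound: "\<bar>sawtooth x\<bar> \<le> 1 / 2"
proof -
  have "of_int \<lfloor>x\<rfloor> \<le> x" "x < of_int \<lfloor>x\<rfloor> + 1" by linarith+
  then have "\<bar>x - of_int \<lfloor>x\<rfloor> - 1 / 2\<bar> \<le> 1 / 2" by linarith
  then show ?thesis by (simp add: sawtooth_def)
qed

lemma sawtooth_diff:
  assumes "\<bar>x - y\<bar> < nd y"
  shows "sawtooth x - sawtooth y = x - y"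
proof -
  have y: "\<bar>x - y\<bar> < y - of_int \<lfloor>y\<rfloor>" "\<bar>x - y\<bar> < of_int \<lfloor>y\<rfloor> + 1 - y"
    using assms nd_le[of y "\<lfloor>y\<rfloor>"] nd_le[of y "\<lfloor>y\<rfloor> + 1"] by (auto simp: abs_if split: if_splits) linarith+
  then have x: "of_int \<lfloor>y\<rfloor> < x" "x < of_int \<lfloor>y\<rfloor> + 1" by linarith+
  then have "\<lfloor>x\<rfloor> = \<lfloor>y\<rfloor>" by (intro floor_unique) auto
  moreover have "x \<notin> \<int>" "y \<notin> \<int>"
    using x y \<open>\<lfloor>x\<rfloor> = \<lfloor>y\<rfloor>\<close> by (auto elim!: Ints_cases)
  ultimately show ?thesis by (simp add: sawtooth_def)
qed

text \<open>The saw-tooth falls from 1/2 to -1/2 at an integer. Left minus right gives the jump a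
  positive sign, so that jumps of different levels add up instead of cancelling.\<close>

lemma sawtooth_Ints:
  assumes "x \<in> \<int>" "0 < h" "h < 1"
  shows "sawtooth (x - h) - sawtooth (x + h) = 1 - 2 * h"
proof -
  obtain k where k: "x = of_int k" using assms by (auto elim: Ints_cases)
  have f: "\<lfloor>x - h\<rfloor> = k - 1" "\<lfloor>x + h\<rfloor> = k" using assms k by linarith+
  have "x - h \<notin> \<int>" "x + h \<notin> \<int>"
    using f assms k by (auto elim!: Ints_cases)
  then show ?thesis using f k by (simp add: sawtooth_def)
qed

section \<open>Lower bound for the Hoelder exponent, by comparison of terms\<close>

context adic_base
begin

lemma summable_powr:
  assumes "0 < \<alpha>"
  shows "summable (\<lambda>i. real b powr - (\<alpha> * real (Suc i)))"
proof -
  have "summable (\<lambda>i. (real b powr - \<alpha>) ^ Suc i)"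
    using real_b assms by (intro iffD2[OF summable_Suc_iff] summable_geometric) (auto simp: powr_less_one)
  then show "summable (\<lambda>i. real b powr - (\<alpha> * real (Suc i)))"
    using real_b by (simp add: powr_power algebra_simps del: power_Suc)
qed

lemma levy_sums:
  assumes "0 < \<alpha>"
  shows "(\<lambda>i. sawtooth (real b ^ Suc i * x) * real b powr - (\<alpha> * real (Suc i))) sums levy \<alpha> b x"
proof -
  have "summable (\<lambda>i. sawtooth (real b ^ Suc i * x) * real b powr - (\<alpha> * real (Suc i)))"
  proof (rule summable_comparison_test')
    show "summable (\<lambda>i. real b powr - (\<alpha> * real (Suc i)))"
      using assms by (rule summable_powr)
    show "norm (sawtooth (real b ^ Suc i * x) * real b powr - (\<alpha> * real (Suc i)))
        \<le> real b powr - (\<alpha> * real (Suc i))" for i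
      using sawtooth_bound[of "real b ^ Suc i * x"]
      by (auto simp: abs_mult intro!: mult_left_le_one_le)
  qed
  moreover have "levy \<alpha> b x = (\<Sum>i. sawtooth (real b ^ Suc i * x) * real b powr - (\<alpha> * real (Suc i)))"
    by (simp only: levy_def powr_minus divide_inverse)
  ultimately show ?thesis by (simp add: summable_sums)
qed

text \<open>Level by level: either \<open>b\<^sup>i x\<^sub>0\<close> and \<open>b\<^sup>i x\<close> are not separated by an integer, so that the saw-tooth
  function is affine between them, or the approximation exponent of \<open>x\<^sub>0\<close> forces \<open>\<bar>x - x\<^sub>0\<bar> \<ge> b\<^sup>-\<^sup>D\<^sup>i\<close>.
  The flag \<open>e\<close> subtracts the linear part, which the Hoelder condition admits only for \<open>\<beta> > 1\<close>.\<close>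

lemma levy_term_bound:
  fixes N :: nat
  assumes "0 < \<beta>" "\<beta> * D < \<alpha>" "1 \<le> D" and e: "e = (if \<beta> \<le> 1 then 0 else 1)"
    and N: "\<And>n. N \<le> n \<Longrightarrow> real b powr - (real n * (D - 1)) < nd (real b ^ n * x\<^sub>0)"
    and r: "\<bar>x - x\<^sub>0\<bar> < real b powr - real N * nd (real b ^ N * x\<^sub>0)"
  shows "\<bar>(sawtooth (real b ^ i * x) - sawtooth (real b ^ i * x\<^sub>0) - e * (real b ^ i * (x - x\<^sub>0)))
      * real b powr - (\<alpha> * real i)\<bar>
    \<le> 3 * \<bar>x - x\<^sub>0\<bar> powr \<beta> * real b powr - ((\<alpha> - \<beta> * D) * real i)"
proof -
  define h where "h = \<bar>x - x\<^sub>0\<bar>"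
  define t where "t = real b ^ i * h"
  define g where "g = sawtooth (real b ^ i * x) - sawtooth (real b ^ i * x\<^sub>0) - e * (real b ^ i * (x - x\<^sub>0))"
  have t: "t = \<bar>real b ^ i * x - real b ^ i * x\<^sub>0\<bar>"
    using real_b by (simp add: t_def h_def abs_mult right_diff_distrib[symmetric])
  have "h \<ge> 0" "t \<ge> 0" by (auto simp: h_def t)
  define R where "R = real b powr - ((\<alpha> - \<beta> * D) * real i)"
  have "\<beta> \<le> \<beta> * D" using assms(1,3) by simp
  \<comment> \<open>\<open>R\<close> is the summable factor left over by
    \<open>\<beta> * D < \<alpha>\<close>. The power \<open>t powr \<beta>\<close> brings in a
    growth \<open>b^(\<beta> i)\<close>, at most the \<open>b^(\<beta> D i)\<close> that
    \<open>R\<close> allows for.\<close>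
  have tR: "t powr \<beta> * real b powr - (\<alpha> * real i) \<le> h powr \<beta> * R"
  proof -
    have "t powr \<beta> = real b powr (\<beta> * real i) * h powr \<beta>"
      using real_b \<open>h \<ge> 0\<close> by (simp add: t_def powr_mult powr_realpow[symmetric] powr_powr mult.commute)
    then have "t powr \<beta> * real b powr - (\<alpha> * real i) = h powr \<beta> * real b powr (\<beta> * real i - \<alpha> * real i)"
      by (simp add: powr_add[symmetric])
    also have "\<dots> \<le> h powr \<beta> * R"
      unfolding R_def using real_b \<open>\<beta> \<le> \<beta> * D\<close>
      by (intro mult_left_mono powr_mono) (auto simp: left_diff_distrib intro!: mult_right_mono)
    finally show ?thesis .
  qed
  have "\<bar>g\<bar> * real b powr - (\<alpha> * real i) \<le> 3 * (h powr \<beta> * R)"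
  proof (cases "t < nd (real b ^ i * x\<^sub>0)")
    case True
    then have g: "g = (1 - e) * (real b ^ i * x - real b ^ i * x\<^sub>0)"
      using sawtooth_diff[of "real b ^ i * x" "real b ^ i * x\<^sub>0"] by (simp add: g_def t algebra_simps)
    have "\<bar>g\<bar> \<le> t powr \<beta>"
    proof (cases "\<beta> \<le> 1")
      case beta: True
      have "t \<le> 1" using True nd_le_half[of "real b ^ i * x\<^sub>0"] by linarith
      then have "t powr 1 \<le> t powr \<beta>" using beta \<open>t \<ge> 0\<close> by (intro powr_mono')
      then show ?thesis using g e beta t \<open>t \<ge> 0\<close> by simp
    qed (use g e in auto)
    then have "\<bar>g\<bar> * real b powr - (\<alpha> * real i) \<le> h powr \<beta> * R"
      using tR by (meson mult_right_mono order_trans powr_ge_zero)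
    then show ?thesis using R_def by (smt (verit) mult_nonneg_nonneg powr_ge_zero)
  next
    case False
    \<comment> \<open>Below level \<open>N\<close> the radius rules out a crossing:
      \<open>b^-N\<close> times the distance at level \<open>N\<close> is at most
      \<open>b^-i\<close> times the distance at level \<open>i\<close>.\<close>
    have "N \<le> i"
    proof (rule ccontr)
      assume "\<not> N \<le> i"
      have "t < real b ^ i * (real b powr - real N * nd (real b ^ N * x\<^sub>0))"
        unfolding t_def using r real_b by (intro mult_strict_left_mono) (auto simp: h_def)
      also have "\<dots> \<le> real b ^ i * (real b powr - real N * (real b powr (real N - real i) * nd (real b ^ i * x\<^sub>0)))"
        using \<open>\<not> N \<le> i\<close> by (intro mult_left_mono nd_power_le) auto
      also have "\<dots> = nd (real b ^ i * x\<^sub>0)"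
        using real_b by (simp add: powr_realpow[symmetric] powr_add[symmetric] mult.assoc[symmetric])
      finally show False using False by simp
    qed
    then have "real b powr - (real i * (D - 1)) < real b powr real i * h"
      using N[of i] False real_b unfolding t_def by (simp add: powr_realpow)
    then have "real b powr - real i * real b powr - (real i * (D - 1))
        \<le> real b powr - real i * (real b powr real i * h)"
      by (intro mult_left_mono) auto
    moreover have "real b powr - real i * real b powr - (real i * (D - 1)) = real b powr - (real i * D)"
      by (simp add: powr_add[symmetric] algebra_simps)
    moreover have "real b powr - real i * (real b powr real i * h) = h"
      using real_b by (simp add: powr_minus)
    ultimately have "real b powr - (real i * D) \<le> h" by simp
    then have "(real b powr - (real i * D)) powr \<beta> \<le> h powr \<beta>"
      using assms(1) by (intro powr_mono2) auto
    then have "real b powr - (\<beta> * D * real i) * R \<le> h powr \<beta> * R"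
      by (intro mult_right_mono) (auto simp: powr_powr R_def algebra_simps)
    \<comment> \<open>A crossing forces \<open>h \<ge> b^(-D i)\<close>, and then
      \<open>h powr \<beta> * R\<close> dominates the full weight of level \<open>i\<close>.\<close>
    then have hR: "real b powr - (\<alpha> * real i) \<le> h powr \<beta> * R"
      by (simp add: R_def powr_add[symmetric] algebra_simps)
    \<comment> \<open>The 2 is paid for by \<open>hR\<close> and the power by \<open>tR\<close>,
      which makes the constant 3. The linear part \<open>e * t\<close> fits in because
      \<open>e\<close> is nonzero only for \<open>\<beta> > 1\<close>.\<close>
    have "\<bar>g\<bar> \<le> 2 + t powr \<beta>"
    proof -
      have "\<bar>g\<bar> \<le> 1 + e * t"
        using sawtooth_bound[of "real b ^ i * x"] sawtooth_bound[of "real b ^ i * x\<^sub>0"] e t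
        unfolding g_def by (auto simp: algebra_simps)
      moreover have "e * t \<le> 1 + t powr \<beta>"
      proof (cases "\<beta> \<le> 1 \<or> t \<le> 1")
        case True
        then show ?thesis using e \<open>t \<ge> 0\<close> by (auto intro: add_increasing2)
      next
        case False
        then have "t powr 1 \<le> t powr \<beta>" by (intro powr_mono) auto
        then show ?thesis using e False by auto
      qed
      ultimately show ?thesis by simp
    qed
    then have "\<bar>g\<bar> * real b powr - (\<alpha> * real i) \<le> (2 + t powr \<beta>) * real b powr - (\<alpha> * real i)"
      by (intro mult_right_mono) auto
    also have "\<dots> = 2 * real b powr - (\<alpha> * real i) + t powr \<beta> * real b powr - (\<alpha> * real i)"
      by (simp add: algebra_simps)
    finally show ?thesis using tR hR by linarith
  qed
  then show ?thesis by (simp add: g_def h_def R_def abs_mult)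
qed

text \<open>A polynomial of degree at most 1 serves for every \<beta>, since the saw-tooth is
  piecewise affine: away from its jumps the term of level \<open>i\<close> has slope
  \<open>b^i b^(-\<alpha> i)\<close>, and the polynomial collects these slopes.\<close>

lemma holder_at_levy:
  assumes "0 < \<beta>" "\<Delta> x\<^sub>0 < ereal D" "\<beta> * D < \<alpha>"
  shows "holder_at \<beta> (levy \<alpha> b) x\<^sub>0"
proof -
  have "1 \<le> D"
    using adic_exponent_ge_1[of x\<^sub>0] assms(2)
    by (metis ereal_less_eq(3) less_imp_le one_ereal_def order_trans)
  then have "\<beta> \<le> \<beta> * D" using assms(1) by simp
  then have "\<beta> < \<alpha>" "0 < \<alpha>" using assms by linarith+
  define e :: real where "e = (if \<beta> \<le> 1 then 0 else 1)"
  \<comment> \<open>The sum of the slopes converges for \<open>\<alpha> > 1\<close>. Otherwise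
    \<open>\<beta> < \<alpha> \<le> 1\<close>, so that \<open>e = 0\<close> removes the unspecified
    value.\<close>
  define s where "s = (\<Sum>i. real b powr - ((\<alpha> - 1) * real (Suc i)))"
  obtain N where N: "\<And>n. N \<le> n \<Longrightarrow> real b powr - (real n * (D - 1)) < nd (real b ^ n * x\<^sub>0)"
    using adic_exponent_lessD[OF assms(2)] by blast
  define r where "r = real b powr - real N * nd (real b ^ N * x\<^sub>0) / 2"
  have "0 < nd (real b ^ N * x\<^sub>0)" using N[of N] by (meson order.refl order_le_less_trans powr_ge_zero)
  then have "r > 0" using real_b by (simp add: r_def)
  define K where "K = (\<Sum>i. 3 * real b powr - ((\<alpha> - \<beta> * D) * real (Suc i)))"
  have sum_K: "summable (\<lambda>i. 3 * real b powr - ((\<alpha> - \<beta> * D) * real (Suc i)))"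
    using assms by (intro summable_mult summable_powr) auto
  define P where "P = [:levy \<alpha> b x\<^sub>0, e * s:]"
  have "real (degree P) < \<beta>"
    using assms(1) by (auto simp: P_def e_def)
  moreover have "\<bar>levy \<alpha> b x - poly P (x - x\<^sub>0)\<bar> \<le> (K + 1) * \<bar>x - x\<^sub>0\<bar> powr \<beta>"
    if "x \<in> {x\<^sub>0 - r..x\<^sub>0 + r}" for x
  proof -
    define T where "T i = (sawtooth (real b ^ Suc i * x) - sawtooth (real b ^ Suc i * x\<^sub>0)
        - e * (real b ^ Suc i * (x - x\<^sub>0))) * real b powr - (\<alpha> * real (Suc i))" for i
    have "(\<lambda>i. e * (x - x\<^sub>0) * real b powr - ((\<alpha> - 1) * real (Suc i))) sums (e * (x - x\<^sub>0) * s)"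
    proof (cases "\<beta> \<le> 1")
      case False
      then have "summable (\<lambda>i. real b powr - ((\<alpha> - 1) * real (Suc i)))"
        using \<open>\<beta> < \<alpha>\<close> by (intro summable_powr) auto
      then show ?thesis unfolding s_def by (intro sums_mult summable_sums)
    qed (simp add: e_def)
    moreover have "real b powr - ((\<alpha> - 1) * real (Suc i))
        = real b ^ Suc i * real b powr - (\<alpha> * real (Suc i))" for i
      using real_b by (simp add: powr_realpow[symmetric] powr_add[symmetric] algebra_simps del: power_Suc)
    ultimately have "(\<lambda>i. e * (real b ^ Suc i * (x - x\<^sub>0)) * real b powr - (\<alpha> * real (Suc i)))
        sums (e * (x - x\<^sub>0) * s)"
      by (simp add: mult_ac del: power_Suc)
    then have "T sums (levy \<alpha> b x - levy \<alpha> b x\<^sub>0 - e * (x - x\<^sub>0) * s)"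
      unfolding T_def left_diff_distrib
      by (intro sums_diff levy_sums \<open>0 < \<alpha>\<close>)
    moreover have "levy \<alpha> b x - levy \<alpha> b x\<^sub>0 - e * (x - x\<^sub>0) * s = levy \<alpha> b x - poly P (x - x\<^sub>0)"
      by (simp add: P_def algebra_simps)
    ultimately have T: "T sums (levy \<alpha> b x - poly P (x - x\<^sub>0))" by simp
    have "\<bar>x - x\<^sub>0\<bar> \<le> r" using that by auto
    then have rx: "\<bar>x - x\<^sub>0\<bar> < real b powr - real N * nd (real b ^ N * x\<^sub>0)"
      using \<open>r > 0\<close> by (auto simp: r_def)
    have bd: "norm (T i) \<le> 3 * real b powr - ((\<alpha> - \<beta> * D) * real (Suc i)) * \<bar>x - x\<^sub>0\<bar> powr \<beta>" for i
      using levy_term_bound[OF assms(1,3) \<open>1 \<le> D\<close> e_def N rx, of "Suc i"]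
      unfolding T_def real_norm_def by (simp only: mult_ac)
    have "norm (levy \<alpha> b x - poly P (x - x\<^sub>0)) \<le> K * \<bar>x - x\<^sub>0\<bar> powr \<beta>"
      unfolding sums_unique[OF T] K_def suminf_mult2[OF sum_K]
      by (rule norm_suminf_le[OF bd summable_mult2[OF sum_K]])
    then show ?thesis by (simp add: algebra_simps) (smt (verit) powr_ge_zero)
  qed
  moreover have "K \<ge> 0" unfolding K_def by (intro suminf_nonneg sum_K) auto
  ultimately show ?thesis
    unfolding holder_at_def using \<open>r > 0\<close>
    by (intro exI[of _ "K + 1"] conjI exI[of _ r] exI[of _ P]) auto
qed

end

section \<open>Jumps at b-adic points and the upper bound for the Hoelder exponent\<close>

lemma sawtooth_jump:
  "((\<lambda>h. sawtooth (x - c * h) - sawtooth (x + c * h)) \<longlongrightarrow> (if x \<in> \<int> then 1 else 0)) (at_right 0)"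
  if "c > 0" for c x :: real
proof (cases "x \<in> \<int>")
  case True
  have "\<forall>\<^sub>F h in at_right 0. h \<in> {0<..<1 / c}"
    using that by (intro eventually_at_right_real) auto
  then have ev: "\<forall>\<^sub>F h in at_right 0. 1 - 2 * (c * h) = sawtooth (x - c * h) - sawtooth (x + c * h)"
  proof eventually_elim
    case (elim h)
    then have "0 < c * h" "c * h < 1" using that by (auto simp: field_simps)
    then show ?case using sawtooth_Ints[OF True] by simp
  qed
  have "((\<lambda>h. 1 - 2 * (c * h)) \<longlongrightarrow> 1 - 2 * (c * 0)) (at_right 0)"
    by (intro tendsto_intros)
  then show ?thesis using True tendsto_cong[OF ev] by simp
next
  case False
  have "0 < nd x"
  proof -
    obtain p where "nd x = \<bar>x - of_int p\<bar>" by (rule nd_attained)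
    then show ?thesis using False by auto
  qed
  then have "\<forall>\<^sub>F h in at_right 0. h \<in> {0<..<nd x / c}"
    using that by (intro eventually_at_right_real) auto
  then have ev: "\<forall>\<^sub>F h in at_right 0. - 2 * (c * h) = sawtooth (x - c * h) - sawtooth (x + c * h)"
  proof eventually_elim
    case (elim h)
    then have "0 < c * h" "c * h < nd x" using that by (auto simp: field_simps)
    then show ?case using sawtooth_diff[of "x - c * h" x] sawtooth_diff[of "x + c * h" x] by simp
  qed
  have "((\<lambda>h. - 2 * (c * h)) \<longlongrightarrow> - 2 * (c * 0)) (at_right 0)"
    by (intro tendsto_intros)
  then show ?thesis using False tendsto_cong[OF ev] by simp
qed

context adic_base
begin

text \<open>Every level from \<open>n\<close> on jumps at \<open>s\<close>, always with the same
  sign, so the total jump is at least that of level \<open>n\<close> alone.\<close>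

lemma levy_jump:
  assumes "0 < \<alpha>" "1 \<le> n" "real b ^ n * s \<in> \<int>"
  obtains J where "real b powr - (\<alpha> * real n) \<le> J"
    "((\<lambda>h. levy \<alpha> b (s - h) - levy \<alpha> b (s + h)) \<longlongrightarrow> J) (at_right 0)"
proof -
  define w where "w i = real b powr - (\<alpha> * real (Suc i))" for i
  define a where "a i h = (sawtooth (real b ^ Suc i * (s - h)) - sawtooth (real b ^ Suc i * (s + h))) * w i" for i h
  define j where "j i = (if real b ^ Suc i * s \<in> \<int> then 1 else 0) * w i" for i
  have w: "0 \<le> w i" for i by (simp add: w_def)
  have sum_w: "summable w" unfolding w_def using assms by (intro summable_powr)
  have lim: "((\<lambda>h. a i h) \<longlongrightarrow> j i) (at_right 0)" for i
    using tendsto_mult[OF sawtooth_jump[of "real b ^ Suc i" "real b ^ Suc i * s"] tendsto_const[of "w i"]] real_b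
    unfolding a_def j_def by (simp only: right_diff_distrib distrib_left zero_less_power)
  have bd: "norm (a i h) \<le> w i" for i h
    using sawtooth_bound[of "real b ^ Suc i * (s - h)"] sawtooth_bound[of "real b ^ Suc i * (s + h)"] w[of i]
    unfolding a_def real_norm_def abs_mult abs_of_nonneg[OF w] by (intro mult_left_le_one_le) auto
  \<comment> \<open>Dominated convergence for series: \<open>w\<close> is a summable majorant that
    does not depend on \<open>h\<close>.\<close>
  have "((\<lambda>h. suminf (\<lambda>i. a i h)) \<longlongrightarrow> suminf j) (at_right 0)"
    by (rule tannerys_theorem[OF lim always_eventually sum_w, THEN conjunct2, THEN conjunct2])
      (use bd in auto)
  moreover have "suminf (\<lambda>i. a i h) = levy \<alpha> b (s - h) - levy \<alpha> b (s + h)" for h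
    unfolding a_def w_def left_diff_distrib
    by (intro sums_unique[symmetric] sums_diff levy_sums assms(1))
  moreover have "real b powr - (\<alpha> * real n) \<le> suminf j"
  proof -
    have "summable j"
      by (rule summable_comparison_test'[OF sum_w, of 0]) (use w in \<open>auto simp: j_def\<close>)
    then have "sum j {n - 1} \<le> suminf j"
      by (rule sum_le_suminf) (use w in \<open>auto simp: j_def\<close>)
    moreover have "Suc (n - 1) = n" using assms(2) by simp
    ultimately show ?thesis using assms(3) by (simp add: j_def w_def)
  qed
  ultimately show ?thesis using that by simp
qed

text \<open>A jump at a nearby \<open>b\<close>-adic point limits the regularity, whatever the polynomial.\<close>

lemma holder_at_levy_imp_le:
  assumes "0 < \<alpha>" "0 < \<beta>" "0 < \<delta>" "holder_at \<beta> (levy \<alpha> b) x\<^sub>0" "ereal \<delta> < \<Delta> x\<^sub>0"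
  shows "\<delta> * \<beta> \<le> \<alpha>"
proof (rule ccontr)
  assume "\<not> \<delta> * \<beta> \<le> \<alpha>"
  obtain C r P where "C > 0" "r > 0"
    and P: "\<And>x. x \<in> {x\<^sub>0 - r..x\<^sub>0 + r} \<Longrightarrow> \<bar>levy \<alpha> b x - poly P (x - x\<^sub>0)\<bar> \<le> C * \<bar>x - x\<^sub>0\<bar> powr \<beta>"
    using assms(4) unfolding holder_at_def by blast
  \<comment> \<open>\<open>s\<close> is a b-adic point of level \<open>n\<close> nearest to
    \<open>x\<^sub>0\<close>. As \<open>h\<close> tends to 0, the continuous polynomial drops out of
    the difference across \<open>s\<close>, and the two Hoelder bounds leave \<open>2 * C\<close>
    times a power of the distance to dominate the jump.\<close>
  have key: "real b powr - (\<alpha> * real n) \<le> 2 * C * (real b powr - (real n * \<delta>)) powr \<beta>"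
    if n: "1 \<le> n" "real b powr - (real n * \<delta>) < r"
      "nd (real b ^ n * x\<^sub>0) \<le> real b powr - (real n * (\<delta> - 1))" for n
  proof -
    obtain p where p: "nd (real b ^ n * x\<^sub>0) = \<bar>real b ^ n * x\<^sub>0 - of_int p\<bar>" by (rule nd_attained)
    define s where "s = of_int p / real b ^ n"
    have "\<bar>s - x\<^sub>0\<bar> = nd (real b ^ n * x\<^sub>0) / real b ^ n"
    proof -
      have "real b ^ n * x\<^sub>0 - of_int p = real b ^ n * (x\<^sub>0 - s)"
        using real_b by (simp add: s_def field_simps)
      then show ?thesis using real_b p by (simp add: abs_mult abs_minus_commute)
    qed
    also have "\<dots> \<le> real b powr - (real n * (\<delta> - 1)) * real b powr - real n"
      using n(3) real_b by (simp add: powr_minus powr_realpow divide_simps)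
    also have "\<dots> = real b powr - (real n * \<delta>)"
      by (simp add: powr_add[symmetric] algebra_simps)
    finally have s: "\<bar>s - x\<^sub>0\<bar> \<le> real b powr - (real n * \<delta>)" .
    obtain J where J: "real b powr - (\<alpha> * real n) \<le> J"
      "((\<lambda>h. levy \<alpha> b (s - h) - levy \<alpha> b (s + h)) \<longlongrightarrow> J) (at_right 0)"
      using levy_jump[of \<alpha> n s] assms(1) n(1) real_b by (auto simp: s_def)
    define rhs where "rhs h = poly P (s - h - x\<^sub>0) - poly P (s + h - x\<^sub>0)
        + (C * \<bar>s - h - x\<^sub>0\<bar> powr \<beta> + C * \<bar>s + h - x\<^sub>0\<bar> powr \<beta>)" for h
    have "(rhs \<longlongrightarrow> poly P (s - 0 - x\<^sub>0) - poly P (s + 0 - x\<^sub>0)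
        + (C * \<bar>s - 0 - x\<^sub>0\<bar> powr \<beta> + C * \<bar>s + 0 - x\<^sub>0\<bar> powr \<beta>)) (at_right 0)"
      unfolding rhs_def using assms(2)
      by (intro tendsto_intros tendsto_powr') auto
    then have lim: "(rhs \<longlongrightarrow> 2 * C * \<bar>s - x\<^sub>0\<bar> powr \<beta>) (at_right 0)" by (simp add: mult.assoc)
    have "\<forall>\<^sub>F h in at_right 0. h \<in> {0<..<r - \<bar>s - x\<^sub>0\<bar>}"
      using s n(2) by (intro eventually_at_right_real) auto
    then have "\<forall>\<^sub>F h in at_right 0. levy \<alpha> b (s - h) - levy \<alpha> b (s + h) \<le> rhs h"
    proof eventually_elim
      case (elim h)
      then have "s - h \<in> {x\<^sub>0 - r..x\<^sub>0 + r}" "s + h \<in> {x\<^sub>0 - r..x\<^sub>0 + r}" by auto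
      from P[OF this(1)] P[OF this(2)] show ?case by (simp add: rhs_def)
    qed
    then have "J \<le> 2 * C * \<bar>s - x\<^sub>0\<bar> powr \<beta>"
      by (intro tendsto_le[OF _ lim J(2)]) auto
    also have "\<dots> \<le> 2 * C * (real b powr - (real n * \<delta>)) powr \<beta>"
      using s assms(2) \<open>C > 0\<close> by (intro mult_left_mono powr_mono2) auto
    finally show ?thesis using J(1) by simp
  qed
  \<comment> \<open>The gain \<open>b^(-\<gamma> n)\<close> on the right of \<open>key\<close>
    eventually beats \<open>2 * C\<close>.\<close>
  define \<gamma> where "\<gamma> = \<delta> * \<beta> - \<alpha>"
  have "\<gamma> > 0" using \<open>\<not> \<delta> * \<beta> \<le> \<alpha>\<close> by (simp add: \<gamma>_def)
  have ev: "\<forall>\<^sub>F n in sequentially. real b powr - (real n * \<epsilon>) < c" if "\<epsilon> > 0" "c > 0" for \<epsilon> c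
  proof -
    have "(\<lambda>n. (real b powr - \<epsilon>) ^ n) \<longlonglongrightarrow> 0"
      using real_b \<open>\<epsilon> > 0\<close> by (intro LIMSEQ_realpow_zero) (auto simp: powr_less_one)
    then have "(\<lambda>n. real b powr - (real n * \<epsilon>)) \<longlonglongrightarrow> 0"
      using real_b by (simp add: powr_power)
    then show ?thesis using \<open>c > 0\<close> order_tendstoD(2) by blast
  qed
  have "\<forall>\<^sub>F n in sequentially. 1 \<le> n \<and> real b powr - (real n * \<delta>) < r
      \<and> real b powr - (real n * \<gamma>) < 1 / (2 * C)"
    using ev[OF \<open>\<delta> > 0\<close> \<open>r > 0\<close>] ev[OF \<open>\<gamma> > 0\<close>, of "1 / (2 * C)"] \<open>C > 0\<close>
    by (intro eventually_conj) (auto intro: eventually_ge_at_top)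
  then obtain N where N: "\<And>n. N \<le> n \<Longrightarrow> 1 \<le> n \<and> real b powr - (real n * \<delta>) < r
      \<and> real b powr - (real n * \<gamma>) < 1 / (2 * C)"
    unfolding eventually_sequentially by blast
  obtain n where n: "N \<le> n" "nd (real b ^ n * x\<^sub>0) \<le> real b powr - (real n * (\<delta> - 1))"
    using adic_exponent_gtD[OF assms(5)] unfolding INFM_nat_le by blast
  have "real b powr - (\<alpha> * real n) \<le> 2 * C * (real b powr - (real n * \<delta>)) powr \<beta>"
    using key N[OF n(1)] n(2) by blast
  also have "(real b powr - (real n * \<delta>)) powr \<beta> = real b powr - (\<alpha> * real n) * real b powr - (real n * \<gamma>)"
    by (simp add: powr_powr powr_add[symmetric] \<gamma>_def algebra_simps)
  also have "2 * C * \<dots> < 2 * C * (real b powr - (\<alpha> * real n) * (1 / (2 * C)))"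
    using N[OF n(1)] \<open>C > 0\<close> real_b by (intro mult_strict_left_mono) auto
  also have "\<dots> = real b powr - (\<alpha> * real n)" using \<open>C > 0\<close> by simp
  finally show False by simp
qed

theorem holder_exponent_levy:
  assumes "0 < \<alpha>"
  shows "holder_exponent (levy \<alpha> b) x = ereal \<alpha> / \<Delta> x"
proof (cases "\<Delta> x")
  case PInf
  \<comment> \<open>Below an infinite exponent every real number is available;
    \<open>(\<alpha> + 1) / \<beta>\<close> violates the bound.\<close>
  have "\<not> holder_at \<beta> (levy \<alpha> b) x" if "\<beta> > 0" for \<beta>
    using holder_at_levy_imp_le[of \<alpha> \<beta> "(\<alpha> + 1) / \<beta>" x] assms that PInf by auto
  then show ?thesis
    using PInf by (simp add: holder_exponent_def cong: conj_cong)
next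
  case (real D)
  then have "D \<ge> 1" using adic_exponent_ge_1[of x] by (simp add: one_ereal_def)
  show ?thesis
  proof (rule antisym)
    have "\<beta> \<le> \<alpha> / D" if "0 < \<beta>" "holder_at \<beta> (levy \<alpha> b) x" for \<beta>
    proof (rule ccontr)
      assume "\<not> \<beta> \<le> \<alpha> / D"
      then have "\<alpha> / \<beta> < D" using \<open>D \<ge> 1\<close> \<open>0 < \<beta>\<close> by (simp add: field_simps)
      then obtain \<delta> where d: "\<alpha> / \<beta> < \<delta>" "\<delta> < D" using dense by blast
      then have "0 < \<delta>" using assms that by (meson divide_pos_pos less_trans)
      then have "\<delta> * \<beta> \<le> \<alpha>"
        using holder_at_levy_imp_le[OF assms that(1) _ that(2), of \<delta>] d real by simp
      with d that show False by (simp add: field_simps)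
    qed
    then show "holder_exponent (levy \<alpha> b) x \<le> ereal \<alpha> / \<Delta> x"
      using assms \<open>D \<ge> 1\<close> real unfolding holder_exponent_def by (auto intro!: Sup_least)
    show "ereal \<alpha> / \<Delta> x \<le> holder_exponent (levy \<alpha> b) x"
    proof (rule dense_le)
      fix e assume e: "e < ereal \<alpha> / \<Delta> x"
      show "e \<le> holder_exponent (levy \<alpha> b) x"
      proof (cases e)
        case r: (real \<beta>)
        show ?thesis
        proof (cases "0 < \<beta>")
          case True
          have "D < \<alpha> / \<beta>" using e r real True \<open>D \<ge> 1\<close> by (simp add: field_simps)
          then obtain D' where "D < D'" "D' < \<alpha> / \<beta>" using dense by blast
          then have "holder_at \<beta> (levy \<alpha> b) x"
            using True real by (intro holder_at_levy[where D = D']) (auto simp: field_simps)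
          then show ?thesis
            using True r unfolding holder_exponent_def by (intro Sup_upper) auto
        next
          case False
          then have "e \<le> 0" using r by simp
          then show ?thesis unfolding holder_exponent_def by (intro Sup_upper2[of 0]) auto
        qed
      qed (use e real \<open>D \<ge> 1\<close> in auto)
    qed
  qed
next
  case MInf
  then show ?thesis using adic_exponent_ge_1[of x] by simp
qed

end

section \<open>Hausdorff measure and well approximable points\<close>

lemma diameter_powr_nonneg [simp]: "0 \<le> diameter_powr s U"
  by (simp add: diameter_powr_def)

lemma dist_powr_le_diameter_powr:
  assumes "bounded U" "x \<in> U" "y \<in> U" "0 \<le> s"
  shows "dist x y powr s \<le> diameter_powr s U"
proof (cases "s = 0")
  case False
  have "dist x y powr s \<le> diameter U powr s"
    using assms by (intro powr_mono2 diameter_bounded_bound) auto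
  then show ?thesis using assms False by (auto simp: diameter_powr_def)
qed (use assms in \<open>auto simp: diameter_powr_def\<close>)

lemma hausdorff_premeasure_mono:
  "E \<subseteq> F \<Longrightarrow> hausdorff_premeasure s \<delta> E \<le> hausdorff_premeasure s \<delta> F"
  unfolding hausdorff_premeasure_def by (rule INF_superset_mono) auto

lemma hausdorff_premeasure_le_diameter:
  assumes "bounded U" "diameter U \<le> \<delta>"
  shows "hausdorff_premeasure s \<delta> U \<le> ennreal (diameter_powr s U)"
proof -
  define V where "V i = (if i = 0 then U else {})" for i :: nat
  have "0 \<le> \<delta>" using assms diameter_ge_0 order_trans by blast
  then have "hausdorff_premeasure s \<delta> U \<le> (\<Sum>i. ennreal (diameter_powr s (V i)))"
    unfolding hausdorff_premeasure_def
    using assms by (intro INF_lower) (auto simp: V_def split: if_splits)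
  also have "\<dots> = (\<Sum>i\<in>{0}. ennreal (diameter_powr s (V i)))"
    by (intro suminf_finite) (auto simp: V_def diameter_powr_def)
  finally show ?thesis by (simp add: V_def)
qed

text \<open>Subadditivity holds at each fixed scale, with errors \<open>e / 2^(k+1)\<close> and an
  enumeration of pairs. Nullity can therefore be proved scale by scale, before the supremum over
  \<delta> is taken.\<close>

lemma hausdorff_premeasure_UN_le:
  fixes E :: "nat \<Rightarrow> 'a::metric_space set"
  shows "hausdorff_premeasure s \<delta> (\<Union>k. E k) \<le> (\<Sum>k. hausdorff_premeasure s \<delta> (E k))"
proof (rule ennreal_le_epsilon)
  fix e :: real assume fin: "(\<Sum>k. hausdorff_premeasure s \<delta> (E k)) < top" and "0 < e"
  define \<eta> where "\<eta> k = ennreal (e * (1 / 2) ^ Suc k)" for k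
  have "\<exists>U. E k \<subseteq> (\<Union>i. U i) \<and> (\<forall>i. bounded (U i) \<and> diameter (U i) \<le> \<delta>) \<and>
      (\<Sum>i. ennreal (diameter_powr s (U i))) \<le> hausdorff_premeasure s \<delta> (E k) + \<eta> k" for k
  proof -
    have "hausdorff_premeasure s \<delta> (E k) < top"
      using fin by (rule ennreal_suminf_lessD)
    moreover have "\<eta> k > 0"
      using \<open>0 < e\<close> by (simp add: \<eta>_def)
    ultimately have "hausdorff_premeasure s \<delta> (E k) < hausdorff_premeasure s \<delta> (E k) + \<eta> k"
      using ennreal_add_left_cancel_less[of "hausdorff_premeasure s \<delta> (E k)" 0 "\<eta> k"] by simp
    then have "\<exists>U\<in>{U. E k \<subseteq> (\<Union>i. U i) \<and> (\<forall>i. bounded (U i) \<and> diameter (U i) \<le> \<delta>)}.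
        (\<Sum>i. ennreal (diameter_powr s (U i))) < hausdorff_premeasure s \<delta> (E k) + \<eta> k"
      unfolding hausdorff_premeasure_def INF_less_iff .
    then show ?thesis unfolding bex_simps mem_Collect_eq by (meson less_imp_le)
  qed
  then have "\<exists>U. \<forall>k. E k \<subseteq> (\<Union>i. U k i) \<and> (\<forall>i. bounded (U k i) \<and> diameter (U k i) \<le> \<delta>) \<and>
      (\<Sum>i. ennreal (diameter_powr s (U k i))) \<le> hausdorff_premeasure s \<delta> (E k) + \<eta> k"
    by (intro choice allI)
  then obtain U where U_all: "\<forall>k. E k \<subseteq> (\<Union>i. U k i) \<and> (\<forall>i. bounded (U k i) \<and> diameter (U k i) \<le> \<delta>) \<and>
      (\<Sum>i. ennreal (diameter_powr s (U k i))) \<le> hausdorff_premeasure s \<delta> (E k) + \<eta> k" ..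
  have U: "\<And>k. E k \<subseteq> (\<Union>i. U k i)" "\<And>k i. bounded (U k i) \<and> diameter (U k i) \<le> \<delta>"
      "\<And>k. (\<Sum>i. ennreal (diameter_powr s (U k i))) \<le> hausdorff_premeasure s \<delta> (E k) + \<eta> k"
    using U_all by simp_all
  define V where "V i = case_prod U (prod_decode i)" for i
  have "(\<Union>k. E k) \<subseteq> (\<Union>i. V i)"
  proof safe
    fix x k assume "x \<in> E k"
    then obtain i where "x \<in> U k i" using U(1) by blast
    then have "x \<in> V (prod_encode (k, i))" by (simp add: V_def)
    then show "x \<in> (\<Union>i. V i)" by blast
  qed
  moreover have "\<forall>i. bounded (V i) \<and> diameter (V i) \<le> \<delta>"
    unfolding V_def using U(2) by (simp add: split_beta)
  ultimately have V: "V \<in> {V. (\<Union>k. E k) \<subseteq> (\<Union>i. V i) \<and> (\<forall>i. bounded (V i) \<and> diameter (V i) \<le> \<delta>)}"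
    by (intro CollectI conjI)
  have "hausdorff_premeasure s \<delta> (\<Union>k. E k) \<le> (\<Sum>i. ennreal (diameter_powr s (V i)))"
    unfolding hausdorff_premeasure_def by (rule INF_lower[OF V])
  also have "\<dots> = (\<Sum>k. \<Sum>i. ennreal (diameter_powr s (U k i)))"
    unfolding V_def
    by (rule suminf_ennreal_2dimen[where f = "\<lambda>p. ennreal (diameter_powr s (case_prod U p))"])
      (simp only: prod.case)
  also have "\<dots> \<le> (\<Sum>k. hausdorff_premeasure s \<delta> (E k) + \<eta> k)"
    by (intro suminf_le U(3)) auto
  also have "\<dots> = (\<Sum>k. hausdorff_premeasure s \<delta> (E k)) + (\<Sum>k. \<eta> k)"
    by (intro suminf_add[symmetric]) auto
  also have "(\<Sum>k. \<eta> k) = ennreal e"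
    unfolding \<eta>_def
  proof (rule suminf_ennreal_eq)
    show "(\<lambda>k. e * (1 / 2) ^ Suc k) sums e"
      using sums_mult[OF power_half_series, of e] by (simp only: mult_1_right)
    show "0 \<le> e * (1 / 2) ^ Suc k" for k using \<open>0 < e\<close> by simp
  qed
  finally show "hausdorff_premeasure s \<delta> (\<Union>k. E k) \<le> (\<Sum>k. hausdorff_premeasure s \<delta> (E k)) + ennreal e" .
qed

lemma hausdorff_premeasure_UN_lessThan_le:
  fixes U :: "nat \<Rightarrow> 'a::metric_space set"
  assumes "\<And>i. i < n \<Longrightarrow> bounded (U i) \<and> diameter (U i) \<le> \<delta>" "0 \<le> \<delta>"
  shows "hausdorff_premeasure s \<delta> (\<Union>i<n. U i) \<le> (\<Sum>i<n. ennreal (diameter_powr s (U i)))"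
proof -
  define V where "V i = (if i < n then U i else {})" for i
  have "(\<Union>i<n. U i) = (\<Union>i. V i)" by (auto simp: V_def split: if_splits)
  then have "hausdorff_premeasure s \<delta> (\<Union>i<n. U i) \<le> (\<Sum>i. hausdorff_premeasure s \<delta> (V i))"
    by (simp add: hausdorff_premeasure_UN_le)
  also have "\<dots> \<le> (\<Sum>i. ennreal (diameter_powr s (V i)))"
    using assms by (intro suminf_le hausdorff_premeasure_le_diameter) (auto simp: V_def)
  also have "\<dots> = (\<Sum>i<n. ennreal (diameter_powr s (V i)))"
    by (intro suminf_finite) (auto simp: V_def diameter_powr_def)
  finally show ?thesis by (simp add: V_def)
qed

text \<open>Mass distribution principle: the inverse of an \<open>s\<close>-Hoelder map onto the unit interval.\<close>

lemma hausdorff_measure_nonzero: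
  fixes \<psi> :: "real \<Rightarrow> 'a::metric_space"
  assumes "0 \<le> s" "0 < C" and \<psi>: "\<And>t. t \<in> {0..<1} \<Longrightarrow> \<psi> t \<in> E"
    and expand: "\<And>t t'. t \<in> {0..<1} \<Longrightarrow> t' \<in> {0..<1} \<Longrightarrow> \<bar>t - t'\<bar> \<le> C * dist (\<psi> t) (\<psi> t') powr s"
  shows "hausdorff_measure s E \<noteq> 0"
proof
  assume "hausdorff_measure s E = 0"
  moreover have "hausdorff_premeasure s 1 E \<le> hausdorff_measure s E"
    unfolding hausdorff_measure_def by (intro SUP_upper) auto
  \<comment> \<open>The threshold keeps the total length of the intervals below under 1.\<close>
  ultimately have "hausdorff_premeasure s 1 E < ennreal (1 / (2 * C))"
    using \<open>0 < C\<close> by simp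
  then obtain U where U: "E \<subseteq> (\<Union>i. U i)" "\<And>i. bounded (U i)"
    and small: "(\<Sum>i. ennreal (diameter_powr s (U i))) < ennreal (1 / (2 * C))"
    unfolding hausdorff_premeasure_def INF_less_iff by auto
  define T where "T i = {t \<in> {0..<1}. \<psi> t \<in> U i}" for i
  \<comment> \<open>\<open>T i\<close> need not be measurable, so it is enclosed in an interval
    about an arbitrary one of its points, of length \<open>2 * C\<close> times the corresponding
    term of the cover.\<close>
  define A where "A i = (if T i = {} then {} else
    {(SOME t. t \<in> T i) - C * diameter_powr s (U i)..(SOME t. t \<in> T i) + C * diameter_powr s (U i)})" for i
  have TA: "T i \<subseteq> A i" for i
  proof
    fix t assume t: "t \<in> T i"
    define c where "c = (SOME t. t \<in> T i)"
    have c: "c \<in> T i" unfolding c_def using t by (rule someI)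
    have "\<bar>t - c\<bar> \<le> C * dist (\<psi> t) (\<psi> c) powr s"
      using t c by (intro expand) (auto simp: T_def)
    also have "\<dots> \<le> C * diameter_powr s (U i)"
      using t c assms U(2) by (intro mult_left_mono dist_powr_le_diameter_powr) (auto simp: T_def)
    finally show "t \<in> A i" using t unfolding A_def c_def[symmetric] by auto
  qed
  have "{0..<1} \<subseteq> (\<Union>i. T i)"
  proof
    fix t :: real assume t: "t \<in> {0..<1}"
    obtain i where "\<psi> t \<in> U i" using subsetD[OF U(1) \<psi>[OF t]] by (rule UN_E)
    then have "t \<in> T i" using t by (simp add: T_def)
    then show "t \<in> (\<Union>i. T i)" by blast
  qed
  also have "\<dots> \<subseteq> (\<Union>i. A i)" by (intro UN_mono subset_refl TA)
  finally have "{0..<1} \<subseteq> (\<Union>i. A i)" .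
  moreover have A_sets: "A i \<in> sets lborel" for i by (simp add: A_def)
  ultimately have "emeasure lborel {0..<1::real} \<le> emeasure lborel (\<Union>i. A i)"
    by (intro emeasure_mono) auto
  also have "\<dots> \<le> (\<Sum>i. emeasure lborel (A i))"
    using A_sets by (intro emeasure_subadditive_countably) auto
  also have "\<dots> \<le> (\<Sum>i. ennreal (2 * C) * ennreal (diameter_powr s (U i)))"
  proof (intro suminf_le summableI)
    fix i
    have "0 \<le> C * diameter_powr s (U i)" using \<open>0 < C\<close> by simp
    then show "emeasure lborel (A i) \<le> ennreal (2 * C) * ennreal (diameter_powr s (U i))"
      using \<open>0 < C\<close> by (simp add: A_def ennreal_mult[symmetric] mult.assoc)
  qed
  also have "\<dots> = ennreal (2 * C) * (\<Sum>i. ennreal (diameter_powr s (U i)))"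
    by simp
  also have "\<dots> < ennreal (2 * C) * ennreal (1 / (2 * C))"
    using small \<open>0 < C\<close> by (intro ennreal_mult_strict_left_mono) auto
  also have "\<dots> = 1"
    using \<open>0 < C\<close> by (simp add: ennreal_mult[symmetric])
  finally show False by simp
qed

context adic_base
begin

text \<open>Counting: a unit interval involves about \<open>b^n\<close> grid points of level
  \<open>n\<close>, each with a ball of radius \<open>b^(-n d)\<close>. The 4 stems from
  \<open>b^n + 3 \<le> 4 b^n\<close>, the power of 2 from the diameters.\<close>

lemma hausdorff_premeasure_level_le:
  fixes K :: int
  assumes "0 < s" "1 \<le> d" "2 * real b powr - (real n * d) \<le> \<delta>"
  shows "hausdorff_premeasure s \<delta>
      {x \<in> {v + of_int K..v + of_int K + 1}. nd (real b ^ n * (x - v)) \<le> real b powr - (real n * (d - 1))}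
    \<le> ennreal (4 * 2 powr s * (real b powr - (d * s - 1)) ^ n)"
    (is "hausdorff_premeasure s \<delta> ?S \<le> _")
proof -
  define r where "r = real b powr - (real n * d)"
  have "r > 0" using real_b by (simp add: r_def)
  \<comment> \<open>The nearest numerators lie between \<open>b^n K - 1\<close> and
    \<open>b^n (K + 1) + 1\<close>; hence the start one grid step to the left and the
    \<open>b^n + 3\<close> balls.\<close>
  define U where "U i = cball (v + of_int K - 1 / real b ^ n + real i / real b ^ n) r" for i :: nat
  have U: "bounded (U i)" "diameter (U i) = 2 * r" "diameter_powr s (U i) = (2 * r) powr s" for i
    using \<open>r > 0\<close> \<open>0 < s\<close> by (auto simp: U_def diameter_powr_def diameter_cball)
  have "?S \<subseteq> (\<Union>i<b ^ n + 3. U i)"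
  proof safe
    fix x assume x: "x \<in> {v + of_int K..v + of_int K + 1}"
      and close: "nd (real b ^ n * (x - v)) \<le> real b powr - (real n * (d - 1))"
    obtain p where p: "nd (real b ^ n * (x - v)) = \<bar>real b ^ n * (x - v) - of_int p\<bar>" by (rule nd_attained)
    have B: "real b ^ n > 0" using real_b by simp
    have half: "\<bar>real b ^ n * (x - v) - of_int p\<bar> \<le> 1 / 2" using p nd_le_half by metis
    have lo: "real b ^ n * of_int K \<le> real b ^ n * (x - v)" and hi: "real b ^ n * (x - v) \<le> real b ^ n * (of_int K + 1)"
      using x B by (auto intro!: mult_left_mono)
    have "real_of_int (int b ^ n * K) - 1 < of_int p" "real_of_int p < of_int (int b ^ n * (K + 1)) + 1"
      using half lo hi unfolding of_int_mult of_int_add of_int_power of_int_of_nat_eq of_int_1 by linarith+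
    then have pr: "int b ^ n * K \<le> p + 1" "p \<le> int b ^ n * (K + 1) + 1" by linarith+
    define i where "i = nat (p + 1 - int b ^ n * K)"
    have i: "int i = p + 1 - int b ^ n * K" using pr by (simp add: i_def)
    then have "int i < int (b ^ n + 3)" using pr by (simp add: algebra_simps)
    then have "i < b ^ n + 3" by linarith
    moreover have "x \<in> U i"
    proof -
      have ri: "real i = of_int p + 1 - real b ^ n * of_int K"
        using arg_cong[OF i, of real_of_int] by simp
      have "x - (v + of_int K - 1 / real b ^ n + real i / real b ^ n)
          = (real b ^ n * (x - v) - of_int p) / real b ^ n"
        unfolding ri using B by (simp add: field_simps)
      then have "\<bar>x - (v + of_int K - 1 / real b ^ n + real i / real b ^ n)\<bar>
          = nd (real b ^ n * (x - v)) / real b ^ n"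
        using p B by (simp add: abs_divide)
      also have "\<dots> \<le> real b powr - (real n * (d - 1)) * real b powr - real n"
        using close B real_b by (simp add: powr_minus powr_realpow divide_simps)
      also have "\<dots> = r" by (simp add: r_def powr_add[symmetric] algebra_simps)
      finally show ?thesis by (simp add: U_def dist_real_def abs_minus_commute)
    qed
    ultimately show "x \<in> (\<Union>i<b ^ n + 3. U i)" by blast
  qed
  then have "hausdorff_premeasure s \<delta> ?S \<le> hausdorff_premeasure s \<delta> (\<Union>i<b ^ n + 3. U i)"
    by (rule hausdorff_premeasure_mono)
  also have "\<dots> \<le> (\<Sum>i<b ^ n + 3. ennreal (diameter_powr s (U i)))"
  proof (rule hausdorff_premeasure_UN_lessThan_le)
    show "0 \<le> \<delta>" using assms(3) \<open>r > 0\<close> unfolding r_def by linarith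
  qed (use U assms(3) in \<open>simp add: r_def\<close>)
  also have "\<dots> = ennreal (real (b ^ n + 3) * (2 * r) powr s)"
    unfolding U by (subst sum_ennreal) auto
  also have "\<dots> \<le> ennreal (4 * 2 powr s * (real b powr - (d * s - 1)) ^ n)"
  proof (rule ennreal_leI)
    have "1 \<le> real b ^ n" using real_b by simp
    then have "real (b ^ n + 3) \<le> 4 * real b ^ n" by simp
    then have "real (b ^ n + 3) * (2 * r) powr s \<le> 4 * real b ^ n * (2 * r) powr s"
      by (intro mult_right_mono) auto
    also have "\<dots> = 4 * 2 powr s * (real b powr real n * r powr s)"
      using \<open>r > 0\<close> real_b by (simp add: powr_mult powr_realpow)
    also have "real b powr real n * r powr s = real b powr (real n * - (d * s - 1))"
      unfolding r_def powr_powr powr_add[symmetric] by (simp add: algebra_simps)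
    also have "\<dots> = (real b powr - (d * s - 1)) ^ n"
      using real_b by (simp only: powr_power simp_thms)
    finally show "real (b ^ n + 3) * (2 * r) powr s \<le> 4 * 2 powr s * (real b powr - (d * s - 1)) ^ n" .
  qed
  finally show ?thesis .
qed

text \<open>The convergence half of Borel-Cantelli: such points belong to infinitely many level
  sets, whose premeasures are bounded by a geometric series of ratio \<open>b^(1 - d s) < 1\<close>.
  Cutting into unit pieces keeps the number of balls per level finite.\<close>

lemma hausdorff_measure_approximable:
  assumes "0 < s" "1 \<le> d" "1 < s * d"
  shows "hausdorff_measure s {x. ereal d < \<Delta> (x - v)} = 0"
proof -
  define E where "E K = {x \<in> {v + of_int K..v + of_int K + 1}. ereal d < \<Delta> (x - v)}" for K :: int
  define q where "q = real b powr - (d * s - 1)"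
  have q: "0 < q" "q < 1" using assms real_b by (auto simp: q_def powr_less_one mult.commute)
  have null: "hausdorff_premeasure s \<delta> (E K) = 0" if "\<delta> > 0" for \<delta> K
  proof -
    have "(\<lambda>n. (real b powr - d) ^ n) \<longlonglongrightarrow> 0"
      using real_b assms(2) by (intro LIMSEQ_realpow_zero) (auto simp: powr_less_one)
    then have "\<forall>\<^sub>F n in sequentially. (real b powr - d) ^ n < \<delta> / 2"
      using \<open>\<delta> > 0\<close> order_tendstoD(2) by (metis half_gt_zero)
    then obtain N0 where N0: "\<And>n. n \<ge> N0 \<Longrightarrow> (real b powr - d) ^ n < \<delta> / 2"
      by (auto simp: eventually_sequentially)
    have "hausdorff_premeasure s \<delta> (E K) \<le> ennreal (4 * 2 powr s / (1 - q) * q ^ N)" if "N \<ge> N0" for N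
    proof -
      define S where "S n = {x \<in> {v + of_int K..v + of_int K + 1}.
        nd (real b ^ n * (x - v)) \<le> real b powr - (real n * (d - 1))}" for n
      have "E K \<subseteq> (\<Union>n. S (n + N))"
      proof
        fix x assume x: "x \<in> E K"
        then obtain n where "N \<le> n" "nd (real b ^ n * (x - v)) \<le> real b powr - (real n * (d - 1))"
          using adic_exponent_gtD[of d "x - v"] unfolding E_def INFM_nat_le by blast
        then have "x \<in> S ((n - N) + N)" using x by (auto simp: S_def E_def)
        then show "x \<in> (\<Union>n. S (n + N))" by blast
      qed
      then have "hausdorff_premeasure s \<delta> (E K) \<le> hausdorff_premeasure s \<delta> (\<Union>n. S (n + N))"
        by (rule hausdorff_premeasure_mono)
      also have "\<dots> \<le> (\<Sum>n. hausdorff_premeasure s \<delta> (S (n + N)))"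
        by (rule hausdorff_premeasure_UN_le)
      also have "\<dots> \<le> (\<Sum>n. ennreal (4 * 2 powr s * q ^ N * q ^ n))"
      proof (intro suminf_le summableI)
        fix n
        have "2 * real b powr - (real (n + N) * d) \<le> \<delta>"
          using N0[of "n + N"] that real_b by (simp add: powr_power mult.commute)
        from hausdorff_premeasure_level_le[OF assms(1,2) this, of v K]
        show "hausdorff_premeasure s \<delta> (S (n + N)) \<le> ennreal (4 * 2 powr s * q ^ N * q ^ n)"
          by (simp add: S_def q_def power_add mult_ac)
      qed
      also have "\<dots> = ennreal (4 * 2 powr s * q ^ N * (1 / (1 - q)))"
        using q by (intro suminf_ennreal_eq sums_mult geometric_sums) auto
      finally show ?thesis by (simp add: field_simps)
    qed
    moreover have "(\<lambda>N. ennreal (4 * 2 powr s / (1 - q) * q ^ N)) \<longlonglongrightarrow> ennreal (4 * 2 powr s / (1 - q) * 0)"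
      using q by (intro tendsto_ennrealI tendsto_intros LIMSEQ_realpow_zero) auto
    ultimately have "hausdorff_premeasure s \<delta> (E K) \<le> ennreal (4 * 2 powr s / (1 - q) * 0)"
      by (intro LIMSEQ_le_const) auto
    then show ?thesis by simp
  qed
  have "{x. ereal d < \<Delta> (x - v)} \<subseteq> (\<Union>k. E (int_decode k))"
  proof
    fix x assume "x \<in> {x. ereal d < \<Delta> (x - v)}"
    then have "x \<in> E (int_decode (int_encode \<lfloor>x - v\<rfloor>))"
      unfolding E_def int_encode_inverse by (simp, linarith)
    then show "x \<in> (\<Union>k. E (int_decode k))" by blast
  qed
  then have cover: "hausdorff_premeasure s \<delta> {x. ereal d < \<Delta> (x - v)}
      \<le> hausdorff_premeasure s \<delta> (\<Union>k. E (int_decode k))" for \<delta>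
    by (rule hausdorff_premeasure_mono)
  have "hausdorff_premeasure s \<delta> {x. ereal d < \<Delta> (x - v)} \<le> 0" if "\<delta> > 0" for \<delta>
  proof -
    note cover[of \<delta>]
    also have "hausdorff_premeasure s \<delta> (\<Union>k. E (int_decode k))
        \<le> (\<Sum>k. hausdorff_premeasure s \<delta> (E (int_decode k)))"
      by (rule hausdorff_premeasure_UN_le)
    also have "\<dots> = 0" using null[OF that] by simp
    finally show ?thesis .
  qed
  then show ?thesis
    unfolding hausdorff_measure_def by (intro antisym SUP_least) (simp_all only: greaterThan_iff zero_le)
qed

end

section \<open>The Cantor set\<close>

context adic_base
begin

text \<open>Levels of good approximation cannot be prescribed, but moving one to the next term of
  the progression \<open>c + l * Suc j\<close> costs at most \<open>l\<close> levels, negligible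
  against a window proportional to the level. The progression lists the ends of consecutive free
  blocks as long as no long block intervenes.\<close>

lemma approximation_window:
  assumes z: "\<Delta> z = ereal \<delta>" and "1 < \<delta>" "0 < \<epsilon>" "1 \<le> l"
  shows "\<exists>j\<ge>J. \<exists>n'. c + l * Suc j \<le> n' \<and> real n' \<le> \<delta> * real (c + l * Suc j) \<and>
    nd (real b ^ (c + l * Suc j) * z) \<le> real b powr - (real n' - real (c + l * Suc j)) \<and>
    (\<delta> - \<epsilon>) * real (c + l * Suc j) \<le> real n'"
proof -
  \<comment> \<open>\<open>\<alpha> > 1\<close> makes the window outlast the shift by
    \<open>l\<close>; \<open>\<alpha> > \<delta> - \<epsilon> / 2\<close> reserves half of
    \<epsilon> for shift and rounding.\<close>
  obtain \<alpha> where \<alpha>: "max 1 (\<delta> - \<epsilon> / 2) < \<alpha>" "\<alpha> < \<delta>"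
    using dense[of "max 1 (\<delta> - \<epsilon> / 2)" \<delta>] assms by auto
  \<comment> \<open>The three thresholds yield, in this order, \<open>j \<ge> J\<close>,
    \<open>m \<le> n'\<close> and the lower bound for \<open>n'\<close>.\<close>
  define L where "L = max (c + l * Suc J) (max (nat \<lceil>(real l + 1) / (\<alpha> - 1)\<rceil>) (nat \<lceil>(\<delta> * real l + 1) / (\<epsilon> / 2)\<rceil>))"
  obtain k where k: "L \<le> k" "nd (real b ^ k * z) \<le> real b powr - (real k * (\<alpha> - 1))"
    using adic_exponent_gtD[of \<alpha> z] z \<alpha> unfolding INFM_nat_le by auto
  have kc: "c + l * Suc J \<le> k" using k(1) unfolding L_def by simp
  have "(real l + 1) / (\<alpha> - 1) \<le> real k" "(\<delta> * real l + 1) / (\<epsilon> / 2) \<le> real k"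
    using k(1) unfolding L_def by (auto simp: nat_le_iff ceiling_le_iff)
  then have k1: "real l + 1 \<le> (\<alpha> - 1) * real k" and k2: "\<delta> * real l + 1 \<le> \<epsilon> / 2 * real k"
    using \<alpha> assms by (auto simp: field_simps)
  define j where "j = (k - c) div l"
  define m where "m = c + l * Suc j"
  have "Suc J * l \<le> k - c" using kc by (simp add: algebra_simps)
  then have "Suc J \<le> j" unfolding j_def using assms(4) by (subst less_eq_div_iff_mult_less_eq) auto
  have "l * j \<le> k - c" "k - c < l * j + l"
    using assms(4) mult_div_mod_eq[of l "k - c"] mod_less_divisor[of l "k - c"] unfolding j_def by linarith+
  then have m: "k \<le> m" "m \<le> k + l" using kc by (auto simp: m_def algebra_simps)
  define n' where "n' = nat \<lfloor>\<alpha> * real k\<rfloor>"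
  have "0 \<le> \<alpha> * real k" using \<alpha> by simp
  then have n': "real n' \<le> \<alpha> * real k" "\<alpha> * real k < real n' + 1"
    unfolding n'_def by (auto simp: of_nat_nat)
  have "real m \<le> real k + real l" using m by linarith
  then have "real m < real n' + 1" using k1 n' by (simp add: algebra_simps)
  then have "m \<le> n'" by linarith
  moreover have "real n' \<le> \<delta> * real m"
  proof -
    have "\<alpha> * real k \<le> \<delta> * real m" using \<alpha> m by (intro mult_mono) auto
    then show ?thesis using n' by linarith
  qed
  moreover have "nd (real b ^ m * z) \<le> real b powr - (real n' - real m)"
  proof -
    have "nd (real b ^ m * z) \<le> real b powr (real m - real k) * nd (real b ^ k * z)"
      using m by (intro nd_power_le)
    also have "\<dots> \<le> real b powr (real m - real k) * real b powr - (real k * (\<alpha> - 1))"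
      using k(2) by (intro mult_left_mono) auto
    also have "\<dots> = real b powr (real m - \<alpha> * real k)"
      by (simp add: powr_add[symmetric] algebra_simps)
    also have "\<dots> \<le> real b powr - (real n' - real m)"
      using n' real_b by (intro powr_mono) auto
    finally show ?thesis .
  qed
  moreover have "(\<delta> - \<epsilon>) * real m \<le> real n'"
  proof -
    have "(\<delta> - \<epsilon>) * (real m - real k) \<le> \<delta> * (real m - real k)"
      using m \<open>0 < \<epsilon>\<close> by (intro mult_right_mono) auto
    also have "\<dots> \<le> \<delta> * real l" using m assms(2) by (intro mult_left_mono) auto
    finally have "(\<delta> - \<epsilon>) * real m \<le> (\<delta> - \<epsilon> / 2) * real k - 1"
      using k2 by (simp add: algebra_simps)
    also have "(\<delta> - \<epsilon> / 2) * real k \<le> \<alpha> * real k"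
      using \<alpha> by (intro mult_right_mono) auto
    finally show ?thesis using n' by linarith
  qed
  ultimately show ?thesis
    using \<open>Suc J \<le> j\<close> unfolding m_def by (intro exI[of _ j] conjI exI[of _ n']) auto
qed

text \<open>The schedule of a Cantor construction: in step \<open>j\<close> the digits \<open>n j, \<dots>, n j + l - 1\<close> are free,
  and the digits \<open>n j + l, \<dots>, n (j + 1) - 1\<close> are prescribed. Blocks with \<open>B j\<close> start only where \<open>z\<close> is
  correspondingly close to the grid of that level. Long blocks are inserted greedily, as soon as the
  fraction of free digits stays above \<open>\<kappa>\<close>; both types take turns, with increasing precision.\<close>

lemma schedule_exists:
  fixes l :: nat
  assumes z: "\<Delta> z = ereal \<delta>\<^sub>2" and "1 \<le> \<delta>\<^sub>1" "\<delta>\<^sub>1 < \<delta>\<^sub>2" "1 \<le> l" "0 < \<kappa>" "\<kappa> * \<delta>\<^sub>2 < 1"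
  obtains n :: "nat \<Rightarrow> nat" and B :: "nat \<Rightarrow> bool"
  where "n 0 = 0" "\<And>j. n j + l \<le> n (Suc j)" "\<And>j. \<kappa> * real (n j) \<le> real (l * j)"
    "\<And>j. B j \<Longrightarrow> real (n (Suc j)) \<le> \<delta>\<^sub>2 * real (n j + l)"
    "\<And>j. B j \<Longrightarrow> nd (real b ^ (n j + l) * z) \<le> real b powr - (real (n (Suc j)) - real (n j + l))"
    "\<And>j. \<not> B j \<Longrightarrow> real (n (Suc j)) \<le> \<delta>\<^sub>1 * real (n j + l)"
    "\<And>\<epsilon> N. \<epsilon> > 0 \<Longrightarrow> \<exists>j\<ge>N. B j \<and> (\<delta>\<^sub>2 - \<epsilon>) * real (n j + l) \<le> real (n (Suc j))"
    "\<And>\<epsilon> N. \<epsilon> > 0 \<Longrightarrow> \<exists>j\<ge>N. \<not> B j \<and> (\<delta>\<^sub>1 - \<epsilon>) * real (n j + l) \<le> real (n (Suc j))"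
proof -
  \<comment> \<open>\<open>k\<close> counts the long blocks inserted so far; its parity selects the
    type and \<open>1 / Suc k\<close> the precision. The block prescribes the digits from
    \<open>m\<close> to just before \<open>n'\<close>.\<close>
  define adm where "adm k m n' \<longleftrightarrow> m \<le> n' \<and>
    (if even k then real n' \<le> \<delta>\<^sub>2 * real m \<and> nd (real b ^ m * z) \<le> real b powr - (real n' - real m)
        \<and> (\<delta>\<^sub>2 - 1 / real (Suc k)) * real m \<le> real n'
      else real n' \<le> \<delta>\<^sub>1 * real m \<and> (\<delta>\<^sub>1 - 1 / real (Suc k)) * real m \<le> real n')" for k m n' :: nat
  define fire where "fire k j n n' \<longleftrightarrow> adm k (n + l) n' \<and> \<kappa> * real n' \<le> real (l * Suc j)" for k j n n' :: nat
  have "\<kappa> \<le> \<kappa> * \<delta>\<^sub>2" using assms by simp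
  then have "\<kappa> < 1" using assms by linarith
  have adm_exists: "\<exists>j\<ge>J. \<exists>n'. adm k (c + l * Suc j) n'" for J c k
  proof (cases "even k")
    case True
    have "\<exists>j\<ge>J. \<exists>n'. c + l * Suc j \<le> n' \<and> real n' \<le> \<delta>\<^sub>2 * real (c + l * Suc j) \<and>
        nd (real b ^ (c + l * Suc j) * z) \<le> real b powr - (real n' - real (c + l * Suc j)) \<and>
        (\<delta>\<^sub>2 - 1 / real (Suc k)) * real (c + l * Suc j) \<le> real n'"
      using assms by (intro approximation_window) auto
    then show ?thesis using True unfolding adm_def by meson
  next
    case False
    \<comment> \<open>With \<open>m \<ge> Suc k\<close> the rounding loss of at most 1 does not
      exceed \<open>m / Suc k\<close>.\<close>
    define m where "m = c + l * Suc (max J k)"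
    define n' where "n' = nat \<lfloor>\<delta>\<^sub>1 * real m\<rfloor>"
    have "Suc k \<le> 1 * Suc (max J k)" by simp
    also have "\<dots> \<le> l * Suc (max J k)" using assms(4) by (rule mult_right_mono) simp
    also have "\<dots> \<le> m" by (simp add: m_def)
    finally have "Suc k \<le> m" .
    then have large: "1 \<le> 1 / real (Suc k) * real m" by (simp add: field_simps)
    have n': "real n' \<le> \<delta>\<^sub>1 * real m" "\<delta>\<^sub>1 * real m < real n' + 1"
      using assms(2) unfolding n'_def by (auto simp: of_nat_nat)
    have "(\<delta>\<^sub>1 - 1 / real (Suc k)) * real m \<le> real n'"
      using large n' unfolding left_diff_distrib by linarith
    moreover have "m \<le> n'"
    proof -
      have "1 * real m \<le> \<delta>\<^sub>1 * real m" using assms(2) by (intro mult_right_mono) auto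
      then have "real m < real n' + 1" using n' by linarith
      then show ?thesis by linarith
    qed
    ultimately have "adm k m n'"
      using False n' unfolding adm_def by simp
    then show ?thesis unfolding m_def by (intro exI[of _ "max J k"]) auto
  qed
  have fire_exists: "\<exists>j\<ge>J. \<exists>n'. fire k j (c + l * j) n'" for J c k
  proof -
    \<comment> \<open>Without insertions the number \<open>c\<close> of prescribed digits stays
      constant. Since \<open>n' \<le> \<delta>\<^sub>2 * m\<close> and
      \<open>\<kappa> * \<delta>\<^sub>2 < 1\<close>, from this point on every admissible block
      leaves the fraction of free digits above \<kappa>.\<close>
    define J' where "J' = max J (nat \<lceil>real c / (1 - \<kappa> * \<delta>\<^sub>2)\<rceil>)"
    obtain j n' where j: "j \<ge> J'" "adm k (c + l * Suc j) n'" using adm_exists by blast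
    define m where "m = c + l * Suc j"
    have "1 * j \<le> l * j" using assms(4) by (rule mult_right_mono) simp
    then have "j \<le> m" unfolding m_def mult_Suc_right by linarith
    moreover have "real c / (1 - \<kappa> * \<delta>\<^sub>2) \<le> real j"
      using j(1) unfolding J'_def by (auto simp: nat_le_iff ceiling_le_iff)
    ultimately have "real c / (1 - \<kappa> * \<delta>\<^sub>2) \<le> real m" by linarith
    then have "real c \<le> (1 - \<kappa> * \<delta>\<^sub>2) * real m" using assms(6) by (simp add: field_simps)
    then have "\<kappa> * (\<delta>\<^sub>2 * real m) \<le> real (l * Suc j)" by (simp add: m_def algebra_simps)
    moreover have "real n' \<le> \<delta>\<^sub>2 * real m"
    proof -
      have "\<delta>\<^sub>1 * real m \<le> \<delta>\<^sub>2 * real m" using assms(3) by (intro mult_right_mono) auto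
      then show ?thesis using j(2) unfolding adm_def m_def[symmetric] by (auto split: if_splits)
    qed
    then have "\<kappa> * real n' \<le> \<kappa> * (\<delta>\<^sub>2 * real m)" using assms(5) by (intro mult_left_mono) auto
    ultimately have "fire k j (c + l * j) n'"
      using j(2) unfolding fire_def by (simp add: algebra_simps)
    then show ?thesis using j(1) unfolding J'_def by auto
  qed
  \<comment> \<open>\<open>k \<le> j\<close> means that task number \<open>i\<close> is not carried
    out before step \<open>i\<close>, which later yields arbitrarily late insertions.\<close>
  define P where "P j = (\<lambda>(n, k). \<kappa> * real n \<le> real (l * j) \<and> l * j \<le> n \<and> k \<le> j
    \<and> (j = 0 \<longrightarrow> n = 0))" for j :: nat
  define Q where "Q j = (\<lambda>(n, k) (n', k'). (fire k j n n' \<and> k' = Suc k)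
    \<or> ((\<nexists>n'. fire k j n n') \<and> n' = n + l \<and> k' = k))" for j :: nat
  have "\<exists>f. \<forall>j. P j (f j) \<and> Q j (f j) (f (Suc j))"
  proof (rule dependent_nat_choice)
    show "\<exists>x. P 0 x" by (intro exI[of _ "(0, 0)"]) (simp add: P_def)
    fix x j assume Px: "P j x"
    obtain n k where x: "x = (n, k)" by (cases x)
    show "\<exists>y. P (Suc j) y \<and> Q j x y"
    proof (cases "\<exists>n'. fire k j n n'")
      case True
      then obtain n' where "fire k j n n'" by blast
      with Px show ?thesis
        by (intro exI[of _ "(n', Suc k)"]) (auto simp: P_def Q_def x fire_def adm_def)
    next
      case False
      have "\<kappa> * real l \<le> 1 * real l" using \<open>\<kappa> < 1\<close> by (intro mult_right_mono) auto
      with False Px show ?thesis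
        by (intro exI[of _ "(n + l, k)"]) (auto simp: P_def Q_def x algebra_simps)
    qed
  qed
  then obtain f where f: "\<And>j. P j (f j)" "\<And>j. Q j (f j) (f (Suc j))" by blast
  define n where "n j = fst (f j)" for j
  define k where "k j = snd (f j)" for j
  have fnk: "f j = (n j, k j)" for j by (simp add: n_def k_def)
  have inv: "\<kappa> * real (n j) \<le> real (l * j)" "l * j \<le> n j" "k j \<le> j" "n 0 = 0" for j
    using f(1)[of j] f(1)[of 0] unfolding fnk P_def by auto
  have step: "(fire (k j) j (n j) (n (Suc j)) \<and> k (Suc j) = Suc (k j))
      \<or> ((\<nexists>n'. fire (k j) j (n j) n') \<and> n (Suc j) = n j + l \<and> k (Suc j) = k j)" for j
    using f(2)[of j] unfolding fnk Q_def by simp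
  \<comment> \<open>If nothing were inserted from \<open>j\<close> on, the positions would follow a
    progression \<open>c + l * i\<close>, along which an insertion eventually becomes possible,
    against greediness.\<close>
  have fires: "\<exists>i\<ge>j. k i = k j \<and> fire (k i) i (n i) (n (Suc i))" for j
  proof (rule ccontr)
    assume "\<not> ?thesis"
    then have no: "\<And>i. j \<le> i \<Longrightarrow> k i = k j \<Longrightarrow> \<not> fire (k i) i (n i) (n (Suc i))" by blast
    define c where "c = n j - l * j"
    have kn: "k (j + i) = k j \<and> n (j + i) = c + l * (j + i)" for i
    proof (induction i)
      case 0
      then show ?case using inv(2)[of j] by (simp add: c_def)
    next
      case (Suc i)
      then show ?case using step[of "j + i"] no[of "j + i"] by auto
    qed
    obtain i n' where i: "i \<ge> j" "fire (k j) i (c + l * i) n'" using fire_exists by blast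
    have "k i = k j" "n i = c + l * i" using kn[of "i - j"] i(1) by auto
    then show False using step[of i] no[of i] i by auto
  qed
  have task: "\<exists>j. k j = i \<and> fire i j (n j) (n (Suc j))" for i
  proof -
    have "\<exists>j. k j = i"
    proof (induction i)
      case 0
      then show ?case using inv(3)[of 0] by auto
    next
      case (Suc i)
      then obtain j where "k j = i" by blast
      then obtain j' where "k j' = i" "fire (k j') j' (n j') (n (Suc j'))" using fires by blast
      then show ?case using step[of j'] by auto
    qed
    then obtain j where "k j = i" by blast
    then show ?thesis using fires[of j] by auto
  qed
  show ?thesis
  proof (rule that[of n "\<lambda>j. even (k j)"])
    \<comment> \<open>In a step without insertion the prescribed part is empty and the required
      closeness is \<open>b^0 = 1\<close>, which always holds; so such a step may carry either
      label.\<close>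
    have nl: "nd x \<le> 1" for x using nd_le_half[of x] by linarith
    show "n j + l \<le> n (Suc j)" for j
      using step[of j] by (auto simp: fire_def adm_def)
    have "n j + l \<le> \<delta> * real (n j + l)" if "1 \<le> \<delta>" for j \<delta>
      using mult_right_mono[OF that, of "real (n j + l)"] by simp
    then show "even (k j) \<Longrightarrow> real (n (Suc j)) \<le> \<delta>\<^sub>2 * real (n j + l)"
      and "\<not> even (k j) \<Longrightarrow> real (n (Suc j)) \<le> \<delta>\<^sub>1 * real (n j + l)" for j
      using step[of j] assms(2,3) by (auto simp: fire_def adm_def)
    show "nd (real b ^ (n j + l) * z) \<le> real b powr - (real (n (Suc j)) - real (n j + l))" if "even (k j)" for j
      using step[of j] that nl real_b by (auto simp: fire_def adm_def)
    fix \<epsilon> :: real and N :: nat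
    assume "\<epsilon> > 0"
    \<comment> \<open>Tasks \<open>2 * i\<close> and \<open>2 * i + 1\<close> are precise enough for
      \<epsilon> and take place no earlier than step \<open>N\<close>.\<close>
    define i where "i = max N (nat \<lceil>1 / \<epsilon>\<rceil>)"
    have close: "(\<delta> - \<epsilon>) * real m \<le> (\<delta> - 1 / real (Suc i')) * real m" if "i \<le> i'" for \<delta> m i'
    proof -
      have "1 / \<epsilon> \<le> real i" unfolding i_def by linarith
      then have "1 / \<epsilon> \<le> real (Suc i')" using that by linarith
      then have "1 / real (Suc i') \<le> \<epsilon>" using \<open>\<epsilon> > 0\<close> by (simp add: field_simps)
      then show ?thesis by (intro mult_right_mono) auto
    qed
    obtain j where j: "k j = 2 * i" "fire (2 * i) j (n j) (n (Suc j))" using task by blast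
    have "N \<le> j" using inv(3)[of j] j(1) by (simp add: i_def)
    moreover have "(\<delta>\<^sub>2 - \<epsilon>) * real (n j + l) \<le> real (n (Suc j))"
      using close[of "2 * i" \<delta>\<^sub>2 "n j + l"] j(2) unfolding fire_def adm_def by auto
    ultimately show "\<exists>j\<ge>N. even (k j) \<and> (\<delta>\<^sub>2 - \<epsilon>) * real (n j + l) \<le> real (n (Suc j))"
      using j(1) by (intro exI[of _ j]) auto
    obtain j where j: "k j = 2 * i + 1" "fire (2 * i + 1) j (n j) (n (Suc j))" using task by blast
    have "N \<le> j" using inv(3)[of j] j(1) by (simp add: i_def)
    moreover have "(\<delta>\<^sub>1 - \<epsilon>) * real (n j + l) \<le> real (n (Suc j))"
      using close[of "2 * i + 1" \<delta>\<^sub>1 "n j + l"] j(2) unfolding fire_def adm_def by auto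
    ultimately show "\<exists>j\<ge>N. \<not> even (k j) \<and> (\<delta>\<^sub>1 - \<epsilon>) * real (n j + l) \<le> real (n (Suc j))"
      using j(1) by (intro exI[of _ j]) auto
  qed (use inv in auto)
qed

end

section \<open>Nested intervals realising a schedule\<close>

context adic_base
begin

text \<open>Four extra digits give a factor 16 even for \<open>b = 2\<close>: the three candidate
  intervals with their gaps take up 8 lengths, and the argument that two hits belong to one grid
  point needs a factor of at least 9.\<close>

lemma powr_minus_4_le: "16 * real b powr - real (m + 4) \<le> real b powr - real m"
proof -
  have "(2::real) ^ 4 \<le> real b ^ 4" using real_b by (intro power_mono) auto
  then have "16 * real b powr - real (m + 4) \<le> real b ^ 4 * real b powr - real (m + 4)"
    by (intro mult_right_mono) auto
  also have "real b ^ 4 = real b powr real 4" using real_b by (intro powr_realpow[symmetric])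
  also have "real b powr real 4 * real b powr - real (m + 4) = real b powr - real m"
    unfolding powr_add[symmetric] by simp
  finally show ?thesis .
qed

text \<open>Among three subintervals spaced by \<open>3 \<rho>\<close>, each of the two grids comes close to at most one.\<close>

lemma free_child:
  fixes d n l :: nat and s u v :: real
  defines "\<rho> \<equiv> real b powr - real (n + l + 4)"
  shows "\<exists>a'. s \<le> a' \<and> a' + 2 * \<rho> \<le> s + real b powr - real (n + l) \<and>
    (\<forall>x\<in>{a'..a' + \<rho>}. \<forall>w\<in>{u, v}. real b powr - real (l + 4) \<le> nd (real b ^ n * (x - w)))"
proof -
  define t where "t = real b powr - real (l + 4)"
  have "\<rho> > 0" using real_b by (simp add: \<rho>_def)
  have t: "real b ^ n * \<rho> = t" using real_b
    by (simp add: \<rho>_def t_def powr_realpow[symmetric] powr_add[symmetric])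
  have "16 * t \<le> 1"
    using powr_minus_4_le[of l] powr_mono[of "- real l" 0 "real b"] real_b by (simp add: t_def)
  define c where "c i = s + 3 * real i * \<rho>" for i :: nat
  define bad where "bad w i \<longleftrightarrow> (\<exists>x\<in>{c i..c i + \<rho>}. nd (real b ^ n * (x - w)) < t)" for w i
  have not_both: False if bads: "bad w i" "bad w i'" and "i < i'" "i' < 3" for w and i i' :: nat
  proof -
    obtain x x' where x: "x \<in> {c i..c i + \<rho>}" "nd (real b ^ n * (x - w)) < t"
      and x': "x' \<in> {c i'..c i' + \<rho>}" "nd (real b ^ n * (x' - w)) < t"
      using bads unfolding bad_def by blast
    obtain p p' where p: "nd (real b ^ n * (x - w)) = \<bar>real b ^ n * (x - w) - of_int p\<bar>"
      and p': "nd (real b ^ n * (x' - w)) = \<bar>real b ^ n * (x' - w) - of_int p'\<bar>"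
      by (metis nd_attained)
    have "real i' \<ge> real i + 1" "real i' \<le> real i + 2" using that by auto
    then have "3 * real i' * \<rho> \<ge> 3 * (real i + 1) * \<rho>" "3 * real i' * \<rho> \<le> 3 * (real i + 2) * \<rho>"
      using \<open>\<rho> > 0\<close> by (auto intro!: mult_right_mono)
    then have "2 * \<rho> \<le> x' - x" "x' - x \<le> 7 * \<rho>"
      using x(1) x'(1) by (auto simp: c_def algebra_simps)
    then have "real b ^ n * (2 * \<rho>) \<le> real b ^ n * (x' - x)" "real b ^ n * (x' - x) \<le> real b ^ n * (7 * \<rho>)"
      using real_b by (auto intro!: mult_left_mono)
    then have gap: "2 * t \<le> real b ^ n * (x' - w) - real b ^ n * (x - w)"
      "real b ^ n * (x' - w) - real b ^ n * (x - w) \<le> 7 * t"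
      using t by (auto simp: algebra_simps)
    \<comment> \<open>A displacement of at most \<open>7 * t\<close> and two errors below
      \<open>t\<close>: less than \<open>9 * t\<close>, hence the same integer. But points at least
      \<open>2 * t\<close> apart cannot both be closer than \<open>t\<close> to it.\<close>
    then have "\<bar>real_of_int (p' - p)\<bar> < 1"
      using x(2) x'(2) p p' \<open>16 * t \<le> 1\<close> by simp
    then have "p = p'" by linarith
    then show False using gap x(2) x'(2) p p' by simp
  qed
  have "\<exists>i<3. \<not> bad u i \<and> \<not> bad v i"
  proof (rule ccontr)
    assume "\<not> ?thesis"
    then have "bad u 0 \<or> bad v 0" "bad u 1 \<or> bad v 1" "bad u 2 \<or> bad v 2" by auto
    then show False
      using not_both[of u 0 1] not_both[of u 0 2] not_both[of u 1 2]
        not_both[of v 0 1] not_both[of v 0 2] not_both[of v 1 2] by auto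
  qed
  then obtain i where "i < 3" "\<not> bad u i" "\<not> bad v i" by blast
  have "3 * real i * \<rho> \<le> 6 * \<rho>" using \<open>i < 3\<close> \<open>\<rho> > 0\<close> by (intro mult_right_mono) auto
  then have "c i + 2 * \<rho> \<le> s + real b powr - real (n + l)"
    using powr_minus_4_le[of "n + l"] \<open>\<rho> > 0\<close> unfolding \<rho>_def c_def by linarith
  moreover have "s \<le> c i" using \<open>\<rho> > 0\<close> by (simp add: c_def)
  moreover have "\<forall>x\<in>{c i..c i + \<rho>}. \<forall>w\<in>{u, v}. t \<le> nd (real b ^ n * (x - w))"
    using \<open>\<not> bad u i\<close> \<open>\<not> bad v i\<close> by (auto simp: bad_def not_less)
  ultimately show ?thesis unfolding t_def by blast
qed

text \<open>An interval of length \<open>b^-m\<close> contains a point of the grid translated by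
  \<open>w\<close>, and any subinterval of length \<open>b^-m'\<close> around that point will
  do.\<close>

lemma forced_child:
  assumes "m \<le> m'"
  shows "\<exists>a'. a \<le> a' \<and> a' + real b powr - real m' \<le> a + real b powr - real m \<and>
    (\<forall>x\<in>{a'..a' + real b powr - real m'}. nd (real b ^ m * (x - w)) \<le> real b powr - (real m' - real m))"
proof -
  define p where "p = \<lceil>real b ^ m * (a - w)\<rceil>"
  define q where "q = w + of_int p / real b ^ m"
  define \<rho> where "\<rho> = real b powr - real m"
  define \<epsilon> where "\<epsilon> = real b powr - real m'"
  have B: "real b ^ m > 0" using real_b by simp
  have \<rho>: "\<rho> = 1 / real b ^ m" using real_b by (simp add: \<rho>_def powr_minus powr_realpow field_simps)
  have "\<epsilon> \<le> \<rho>" "\<epsilon> > 0" using assms real_b by (auto simp: \<epsilon>_def \<rho>_def)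
  have "real b ^ m * (a - w) \<le> of_int p" "of_int p \<le> real b ^ m * (a - w) + 1"
    unfolding p_def by linarith+
  from this[THEN divide_right_mono, of "real b ^ m"]
  have "real b ^ m * (a - w) / real b ^ m \<le> of_int p / real b ^ m"
    "of_int p / real b ^ m \<le> (real b ^ m * (a - w) + 1) / real b ^ m"
    using B by (simp_all only: less_imp_le)
  then have q: "a \<le> q" "q \<le> a + \<rho>"
    using real_b by (auto simp: q_def \<rho> add_divide_distrib)
  \<comment> \<open>Start at \<open>q\<close>, or, if that overruns the right end, as far to the
    right as possible; \<open>q\<close> is then still inside.\<close>
  define a' where "a' = min q (a + \<rho> - \<epsilon>)"
  have "nd (real b ^ m * (x - w)) \<le> real b powr - (real m' - real m)" if "x \<in> {a'..a' + \<epsilon>}" for x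
  proof -
    have "nd (real b ^ m * (x - w)) \<le> \<bar>real b ^ m * (x - w) - of_int p\<bar>" by (rule nd_le)
    also have "real b ^ m * (x - w) - of_int p = real b ^ m * (x - q)"
      using B by (simp add: q_def field_simps)
    also have "\<bar>real b ^ m * (x - q)\<bar> = real b ^ m * \<bar>x - q\<bar>" by (simp add: abs_mult)
    also have "\<dots> \<le> real b ^ m * \<epsilon>"
      using that q \<open>\<epsilon> \<le> \<rho>\<close> B by (intro mult_left_mono) (auto simp: a'_def min_def split: if_splits)
    also have "\<dots> = real b powr - (real m' - real m)"
      using real_b by (simp add: \<epsilon>_def powr_realpow[symmetric] powr_add[symmetric])
    finally show ?thesis .
  qed
  moreover have "a \<le> a'" "a' + \<epsilon> \<le> a + \<rho>" using q \<open>\<epsilon> \<le> \<rho>\<close> by (auto simp: a'_def)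
  ultimately show ?thesis unfolding \<epsilon>_def \<rho>_def by blast
qed

text \<open>\<open>d\<close> selects a cell of length \<open>b^-(n + l)\<close> in the parent
  interval at \<open>a\<close>. The summand \<open>b^-(n + l + 4)\<close> keeps a gap before the
  next cell, which later separates points. Of \<open>l + 4\<close> unprescribed levels only
  \<open>l\<close> carry a choice; the other 4 pay for avoiding both grids at level
  \<open>n\<close>. The remaining levels up to \<open>n'\<close> follow \<open>w\<close>.\<close>

definition good_child :: "nat \<Rightarrow> real \<Rightarrow> real \<Rightarrow> real \<Rightarrow> nat \<Rightarrow> nat \<Rightarrow> real \<Rightarrow> nat \<Rightarrow> real \<Rightarrow> bool" where
  "good_child l u v w n n' a d a' \<longleftrightarrow>
    a + real d * real b powr - real (n + l) \<le> a' \<and>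
    a' + real b powr - real n' + real b powr - real (n + l + 4) \<le> a + real (Suc d) * real b powr - real (n + l) \<and>
    (\<forall>x\<in>{a'..a' + real b powr - real n'}.
      real b powr - real (l + 4) \<le> nd (real b ^ n * (x - u)) \<and>
      real b powr - real (l + 4) \<le> nd (real b ^ n * (x - v)) \<and>
      nd (real b ^ (n + (l + 4)) * (x - w)) \<le> real b powr - (real n' - real (n + (l + 4))))"

lemma good_child_exists:
  assumes "n + (l + 4) \<le> n'"
  shows "\<exists>a'. good_child l u v w n n' a d a'"
proof -
  obtain c where c: "a + real d * real b powr - real (n + l) \<le> c"
      "c + 2 * real b powr - real (n + l + 4) \<le> a + real d * real b powr - real (n + l) + real b powr - real (n + l)"
    and cx: "\<And>x w. x \<in> {c..c + real b powr - real (n + l + 4)} \<Longrightarrow> w \<in> {u, v} \<Longrightarrow>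
      real b powr - real (l + 4) \<le> nd (real b ^ n * (x - w))"
    using free_child[of "a + real d * real b powr - real (n + l)" n l u v] by blast
  obtain a' where a': "c \<le> a'" "a' + real b powr - real n' \<le> c + real b powr - real (n + l + 4)"
    and ax: "\<And>x. x \<in> {a'..a' + real b powr - real n'} \<Longrightarrow>
      nd (real b ^ (n + (l + 4)) * (x - w)) \<le> real b powr - (real n' - real (n + (l + 4)))"
    using forced_child[OF assms, of c w] by (auto simp: add.assoc)
  have "real b powr - real (l + 4) \<le> nd (real b ^ n * (x - w))"
    if "x \<in> {a'..a' + real b powr - real n'}" "w \<in> {u, v}" for x w
    using that a' by (intro cx) auto
  then show ?thesis
    unfolding good_child_def using c a' ax
    by (intro exI[of _ a'] conjI ballI) (auto simp: distrib_right)
qed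

text \<open>Induction step showing that equal digits give equal floors. Digits read off from floors
  avoid the ambiguity of expansions.\<close>

lemma floor_base_step:
  fixes t :: real
  assumes "M > 0"
  shows "\<lfloor>real M ^ Suc j * t\<rfloor> = int M * \<lfloor>real M ^ j * t\<rfloor> + \<lfloor>real M ^ Suc j * t\<rfloor> mod int M"
proof -
  have "\<lfloor>real M ^ j * t\<rfloor> = \<lfloor>real M ^ Suc j * t / real_of_int (int M)\<rfloor>"
    using assms by simp
  also have "\<dots> = \<lfloor>real M ^ Suc j * t\<rfloor> div int M"
    by (rule floor_divide_real_eq_div) simp
  finally show ?thesis by (metis mult_div_mod_eq)
qed

text \<open>The base \<open>b^l\<close> digits of \<open>t\<close> select the cells, and
  \<open>\<psi> t\<close> is the common point of the nested intervals. At the first differing digit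
  the parents still coincide, so the gap between cells separates the images.\<close>

lemma cantor_points:
  fixes n :: "nat \<Rightarrow> nat" and w :: "nat \<Rightarrow> real"
  assumes "n 0 = 0" "\<And>j. n j + (l + 4) \<le> n (Suc j)" "1 \<le> l"
  obtains \<psi> :: "real \<Rightarrow> real"
  where "\<And>t j. real b powr - real (l + 4) \<le> nd (real b ^ n j * (\<psi> t - u))"
    "\<And>t j. real b powr - real (l + 4) \<le> nd (real b ^ n j * (\<psi> t - v))"
    "\<And>t j. nd (real b ^ (n j + (l + 4)) * (\<psi> t - w j)) \<le> real b powr - (real (n (Suc j)) - real (n j + (l + 4)))"
    "\<And>t t'. t \<in> {0..<1} \<Longrightarrow> t' \<in> {0..<1} \<Longrightarrow> t \<noteq> t' \<Longrightarrow>
      \<exists>j. \<bar>t - t'\<bar> \<le> real b powr - real (l * j) \<and> real b powr - real (n j + (l + 4)) \<le> \<bar>\<psi> t - \<psi> t'\<bar>"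
proof -
  define M where "M = b ^ l"
  have "1 < M" using b_ge_2 assms(3) unfolding M_def by (intro one_less_power) auto
  then have "0 < M" by simp
  define r where "r j = real b powr - real (n j)" for j
  define child where "child j a d = (SOME a'. good_child l u v (w j) (n j) (n (Suc j)) a d a')" for j a d
  have child: "good_child l u v (w j) (n j) (n (Suc j)) a d (child j a d)" for j a d
    unfolding child_def by (rule someI_ex) (rule good_child_exists[OF assms(2)])
  define dig where "dig t j = nat (\<lfloor>real M ^ Suc j * t\<rfloor> mod int M)" for t :: real and j :: nat
  have dig: "int (dig t j) = \<lfloor>real M ^ Suc j * t\<rfloor> mod int M" "dig t j < M" for t j
    using \<open>0 < M\<close> by (auto simp: dig_def nat_less_iff)
  define a where "a t = rec_nat 0 (\<lambda>j x. child j x (dig t j))" for t :: real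
  have a_Suc: "a t (Suc j) = child j (a t j) (dig t j)" for t j by (simp add: a_def)
  define g where "g j = real b powr - real (n j + l)" for j
  have Mg: "real M * g j = r j" for j
    using real_b by (simp add: M_def g_def r_def powr_realpow[symmetric] powr_add[symmetric])
  have pos: "r j > 0" "g j > 0" for j using real_b by (auto simp: r_def g_def)
  have step: "a t j + real (dig t j) * g j \<le> a t (Suc j)"
      "a t (Suc j) + r (Suc j) + real b powr - real (n j + (l + 4)) \<le> a t j + real (Suc (dig t j)) * g j"
    and stepx: "x \<in> {a t (Suc j)..a t (Suc j) + r (Suc j)} \<Longrightarrow>
      real b powr - real (l + 4) \<le> nd (real b ^ n j * (x - u)) \<and>
      real b powr - real (l + 4) \<le> nd (real b ^ n j * (x - v)) \<and>
      nd (real b ^ (n j + (l + 4)) * (x - w j)) \<le> real b powr - (real (n (Suc j)) - real (n j + (l + 4)))" for t j x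
    using child[of j "a t j" "dig t j"]
    unfolding good_child_def a_Suc r_def g_def add.assoc by blast+
  have "incseq (a t)" for t
  proof (rule incseq_SucI)
    fix j
    have "0 \<le> real (dig t j) * g j" using pos(2)[of j] by simp
    then show "a t j \<le> a t (Suc j)" using step(1)[of t j] by linarith
  qed
  moreover have "decseq (\<lambda>j. a t j + r j)" for t
  proof (rule decseq_SucI)
    fix j
    have "real (Suc (dig t j)) * g j \<le> real M * g j"
      using dig(2)[of t j] pos(2)[of j] by (intro mult_right_mono) auto
    moreover have "0 \<le> real b powr - real (n j + (l + 4))" by simp
    ultimately show "a t (Suc j) + r (Suc j) \<le> a t j + r j"
      using step(2)[of t j] unfolding Mg by linarith
  qed
  ultimately have nest: "a t i \<le> a t j + r j" for t i j
  proof -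
    have "a t i \<le> a t (max i j)" using \<open>\<And>t. incseq (a t)\<close> by (simp add: incseq_def)
    also have "\<dots> \<le> a t (max i j) + r (max i j)" using pos(1)[of "max i j"] by simp
    also have "\<dots> \<le> a t j + r j" using \<open>\<And>t. decseq (\<lambda>j. a t j + r j)\<close>[of t] by (simp add: decseq_def)
    finally show ?thesis .
  qed
  define \<psi> where "\<psi> t = (SUP j. a t j)" for t
  have "bdd_above (range (a t))" for t using nest[of t _ 0] by (intro bdd_aboveI2)
  then have \<psi>: "\<psi> t \<in> {a t j..a t j + r j}" for t j
    unfolding \<psi>_def by (auto intro!: cSUP_upper cSUP_least nest)
  show ?thesis
  proof (rule that[of \<psi>])
    fix t t' :: real assume t: "t \<in> {0..<1}" "t' \<in> {0..<1}" "t \<noteq> t'"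
    have floor_eq: "\<lfloor>real M ^ j * t\<rfloor> = \<lfloor>real M ^ j * t'\<rfloor>" if "\<And>i. i < j \<Longrightarrow> dig t i = dig t' i" for j
      using that
    proof (induction j)
      case 0
      have "\<lfloor>t\<rfloor> = 0" "\<lfloor>t'\<rfloor> = 0" using t by (auto simp: floor_eq_iff)
      then show ?case by simp
    next
      case (Suc j)
      then show ?case
        using floor_base_step[OF \<open>0 < M\<close>, of j t] floor_base_step[OF \<open>0 < M\<close>, of j t'] dig(1)[of t j] dig(1)[of t' j]
        by (metis less_Suc_eq)
    qed
    have close: "\<bar>t - t'\<bar> \<le> 1 / real M ^ j" if "\<lfloor>real M ^ j * t\<rfloor> = \<lfloor>real M ^ j * t'\<rfloor>" for j
    proof -
      have "\<bar>real M ^ j * t - real M ^ j * t'\<bar> \<le> 1" using that by linarith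
      then have "real M ^ j * \<bar>t - t'\<bar> \<le> 1"
        unfolding right_diff_distrib[symmetric] abs_mult by simp
      then show ?thesis using \<open>0 < M\<close> by (simp add: field_simps)
    qed
    have "\<exists>j. dig t j \<noteq> dig t' j"
    proof (rule ccontr)
      assume "\<nexists>j. dig t j \<noteq> dig t' j"
      then have "\<bar>t - t'\<bar> \<le> 1 / real M ^ j" for j
        by (intro close floor_eq) auto
      moreover have "(\<lambda>j. 1 / real M ^ j) \<longlonglongrightarrow> 0"
        using \<open>1 < M\<close> LIMSEQ_realpow_zero[of "1 / real M"] by (simp add: power_one_over)
      ultimately have "\<bar>t - t'\<bar> \<le> 0" by (intro LIMSEQ_le_const) auto
      then show False using t(3) by simp
    qed
    then obtain j where j: "dig t j \<noteq> dig t' j" "\<And>i. i < j \<Longrightarrow> dig t i = dig t' i"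
      using exists_least_iff[of "\<lambda>j. dig t j \<noteq> dig t' j"] by blast
    have "a t i = a t' i" if "i \<le> j" for i
      using that
    proof (induction i)
      case 0
      then show ?case by (simp add: a_def)
    next
      case (Suc i)
      then show ?case using j(2)[of i] by (simp add: a_Suc)
    qed
    then have aj: "a t j = a t' j" by simp
    have gap: "\<psi> s + real b powr - real (n j + (l + 4)) \<le> \<psi> s'"
      if "a s j = a s' j" "dig s j < dig s' j" for s s'
    proof -
      have "real (Suc (dig s j)) * g j \<le> real (dig s' j) * g j"
        using that(2) pos(2)[of j] by (intro mult_right_mono) auto
      then show ?thesis
        using step(2)[of s j] step(1)[of s' j] \<psi>[of s "Suc j"] \<psi>[of s' "Suc j"] that(1)
        by auto
    qed
    have "real b powr - real (n j + (l + 4)) \<le> \<bar>\<psi> t - \<psi> t'\<bar>"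
    proof (cases "dig t j < dig t' j")
      case True
      then show ?thesis using gap[OF aj] by linarith
    next
      case False
      then have "dig t' j < dig t j" using j(1) by simp
      then show ?thesis using gap[OF aj[symmetric]] by linarith
    qed
    moreover have "\<bar>t - t'\<bar> \<le> real b powr - real (l * j)"
    proof -
      have "1 / real M ^ j = real b powr - real (l * j)"
        using real_b by (simp add: M_def powr_minus powr_realpow power_mult[symmetric] field_simps del: of_nat_mult)
      moreover have "\<bar>t - t'\<bar> \<le> 1 / real M ^ j" by (rule close[OF floor_eq]) (rule j(2))
      ultimately show ?thesis by simp
    qed
    ultimately show "\<exists>j. \<bar>t - t'\<bar> \<le> real b powr - real (l * j) \<and> real b powr - real (n j + (l + 4)) \<le> \<bar>\<psi> t - \<psi> t'\<bar>"
      by blast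
  qed (use stepx[OF \<psi>] in blast)+
qed

end

section \<open>The level sets\<close>

context adic_base
begin

text \<open>Formulated for two translates, so that either of the two functions can take the role of
  \<open>v\<close>, the side with the larger exponent.\<close>

lemma hausdorff_measure_pair_nonzero:
  assumes u: "\<Delta> (x\<^sub>0 - u) = ereal \<delta>\<^sub>1" and v: "\<Delta> (x\<^sub>0 - v) = ereal \<delta>\<^sub>2"
    and "\<delta>\<^sub>1 < \<delta>\<^sub>2" "0 \<le> s" "s * \<delta>\<^sub>2 < 1"
  shows "hausdorff_measure s {x. \<Delta> (x - u) = ereal \<delta>\<^sub>1 \<and> \<Delta> (x - v) = ereal \<delta>\<^sub>2} \<noteq> 0"
proof -
  have "1 \<le> \<delta>\<^sub>1" using adic_exponent_ge_1[of "x\<^sub>0 - u"] u by (simp add: one_ereal_def)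
  then have "1 < \<delta>\<^sub>2" using assms by simp
  then have "s < 1 / \<delta>\<^sub>2" using assms by (simp add: field_simps)
  \<comment> \<open>\<kappa> is the fraction of free levels demanded from the schedule. Being larger
    than \<open>s\<close>, it leaves the slack \<open>\<sigma> < 1\<close> to pay for the 4 levels
    lost in each step.\<close>
  then obtain \<kappa> where "s < \<kappa>" "\<kappa> < 1 / \<delta>\<^sub>2" using dense by blast
  then have \<kappa>: "0 < \<kappa>" "\<kappa> * \<delta>\<^sub>2 < 1" using assms \<open>1 < \<delta>\<^sub>2\<close> by (auto simp: field_simps)
  define \<sigma> where "\<sigma> = s / \<kappa>"
  have \<sigma>: "0 \<le> \<sigma>" "\<sigma> < 1" "s = \<sigma> * \<kappa>" using \<open>s < \<kappa>\<close> \<kappa> assms by (auto simp: \<sigma>_def)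
  \<comment> \<open>Large enough for \<open>\<sigma> * l \<le> l - 4\<close>.\<close>
  define L where "L = Suc (nat \<lceil>4 / (1 - \<sigma>)\<rceil>)"
  define l where "l = L + 4"
  have "1 \<le> L" "1 \<le> l" by (auto simp: L_def l_def)
  have "4 / (1 - \<sigma>) \<le> real l" unfolding l_def L_def by linarith
  then have \<sigma>L: "\<sigma> * real l \<le> real L" using \<sigma> by (simp add: field_simps l_def)
  obtain n :: "nat \<Rightarrow> nat" and B where n0: "n 0 = 0" and nl: "\<And>j. n j + l \<le> n (Suc j)"
    and n\<kappa>: "\<And>j. \<kappa> * real (n j) \<le> real (l * j)"
    and B\<delta>: "\<And>j. B j \<Longrightarrow> real (n (Suc j)) \<le> \<delta>\<^sub>2 * real (n j + l)"
    and Bx: "\<And>j. B j \<Longrightarrow> nd (real b ^ (n j + l) * (x\<^sub>0 - v)) \<le> real b powr - (real (n (Suc j)) - real (n j + l))"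
    and nB\<delta>: "\<And>j. \<not> B j \<Longrightarrow> real (n (Suc j)) \<le> \<delta>\<^sub>1 * real (n j + l)"
    and B_inf: "\<And>\<epsilon> N. \<epsilon> > 0 \<Longrightarrow> \<exists>j\<ge>N. B j \<and> (\<delta>\<^sub>2 - \<epsilon>) * real (n j + l) \<le> real (n (Suc j))"
    and nB_inf: "\<And>\<epsilon> N. \<epsilon> > 0 \<Longrightarrow> \<exists>j\<ge>N. \<not> B j \<and> (\<delta>\<^sub>1 - \<epsilon>) * real (n j + l) \<le> real (n (Suc j))"
    using schedule_exists[OF v \<open>1 \<le> \<delta>\<^sub>1\<close> \<open>\<delta>\<^sub>1 < \<delta>\<^sub>2\<close> \<open>1 \<le> l\<close> \<kappa>] by blast
  define w where "w j = (if B j then v else u)" for j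
  obtain \<psi> :: "real \<Rightarrow> real"
    where \<psi>u: "\<And>t j. real b powr - real l \<le> nd (real b ^ n j * (\<psi> t - u))"
      and \<psi>v: "\<And>t j. real b powr - real l \<le> nd (real b ^ n j * (\<psi> t - v))"
      and \<psi>w: "\<And>t j. nd (real b ^ (n j + l) * (\<psi> t - w j)) \<le> real b powr - (real (n (Suc j)) - real (n j + l))"
      and sep: "\<And>t t'. t \<in> {0..<1} \<Longrightarrow> t' \<in> {0..<1} \<Longrightarrow> t \<noteq> t' \<Longrightarrow>
        \<exists>j. \<bar>t - t'\<bar> \<le> real b powr - real (L * j) \<and> real b powr - real (n j + l) \<le> \<bar>\<psi> t - \<psi> t'\<bar>"
    using cantor_points[OF n0 nl[unfolded l_def] \<open>1 \<le> L\<close>, of u v w, folded l_def] by blast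
  have j_le: "j \<le> n j" for j
  proof (induction j)
    case (Suc j)
    then show ?case using nl[of j] \<open>1 \<le> l\<close> by linarith
  qed simp
  \<comment> \<open>A run of free levels is no longer than \<open>l\<close>, so
    \<open>{k..k + l}\<close> always meets a prescribed range; its end points count as well.\<close>
  have window: "\<exists>j. \<exists>k'\<in>{k..k + l}. n j + l \<le> k' \<and> k' \<le> n (Suc j)" for k
  proof -
    have "\<exists>j. k < n j" using j_le[of "Suc k"] by (intro exI[of _ "Suc k"]) simp
    then obtain j where j: "k < n j" "\<And>i. i < j \<Longrightarrow> \<not> k < n i"
      using exists_least_iff[of "\<lambda>j. k < n j"] by blast
    then obtain i where i: "j = Suc i" using n0 by (cases j) auto
    then show ?thesis using j(1) j(2)[of i] nl[of i]
      by (intro exI[of _ i] bexI[of _ "max k (n i + l)"]) auto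
  qed
  \<comment> \<open>Avoiding a grid at level \<open>n i\<close> bounds all earlier levels from
    below, as if the approximation broke off at \<open>n i\<close>, up to the factor
    \<open>b^-l\<close>.\<close>
  have crude: "real b powr - real l * real b powr - (real (n i) - real k) \<le> nd (real b ^ k * z)"
    if "k \<le> n i" "real b powr - real l \<le> nd (real b ^ n i * z)" for k i z
  proof -
    have "real b powr - real l \<le> real b powr (real (n i) - real k) * nd (real b ^ k * z)"
      using that(2) nd_power_le[OF that(1)] by (rule order_trans)
    then have "real b powr - real l * real b powr - (real (n i) - real k)
        \<le> real b powr (real (n i) - real k) * nd (real b ^ k * z) * real b powr - (real (n i) - real k)"
      by (intro mult_right_mono) auto
    also have "\<dots> = nd (real b ^ k * z) * (real b powr (real (n i) - real k) * real b powr - (real (n i) - real k))"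
      by (simp only: mult_ac)
    also have "real b powr (real (n i) - real k) * real b powr - (real (n i) - real k) = 1"
      unfolding powr_add[symmetric] using real_b by simp
    finally show ?thesis by simp
  qed
  \<comment> \<open>A block ending at no more than \<delta> times its starting level looks, from any
    of its levels, like an approximation of exponent at most \<delta>.\<close>
  have block: "real b powr - (real k * (\<delta> + \<epsilon> - 1)) \<le> real b powr - (real (n (Suc j)) - real k)"
    if "real (n (Suc j)) \<le> \<delta> * real (n j + l)" "n j + l \<le> k" "1 \<le> \<delta>" "0 \<le> \<epsilon>" for j k \<delta> \<epsilon>
  proof -
    have "\<delta> * real (n j + l) \<le> (\<delta> + \<epsilon>) * real k" using that by (intro mult_mono) auto
    then have "real (n (Suc j)) - real k \<le> real k * (\<delta> + \<epsilon> - 1)"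
      using that(1) by (simp add: algebra_simps)
    then show ?thesis using real_b by (intro powr_mono) auto
  qed
  have inf_block: "\<exists>\<^sub>\<infinity>k. nd (real b ^ k * z) \<le> real b powr - (real k * (\<delta> - \<epsilon> - 1))"
    if ex: "\<And>N. \<exists>j\<ge>N. nd (real b ^ (n j + l) * z) \<le> real b powr - (real (n (Suc j)) - real (n j + l))
      \<and> (\<delta> - \<epsilon>) * real (n j + l) \<le> real (n (Suc j))" for z \<delta> \<epsilon>
    unfolding INFM_nat_le
  proof
    fix N
    obtain j where j: "j \<ge> N" "nd (real b ^ (n j + l) * z) \<le> real b powr - (real (n (Suc j)) - real (n j + l))"
      "(\<delta> - \<epsilon>) * real (n j + l) \<le> real (n (Suc j))" using ex[of N] by blast
    note j(2)
    also have "real b powr - (real (n (Suc j)) - real (n j + l)) \<le> real b powr - (real (n j + l) * (\<delta> - \<epsilon> - 1))"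
      using j(3) real_b by (intro powr_mono) (auto simp: algebra_simps)
    finally show "\<exists>k\<ge>N. nd (real b ^ k * z) \<le> real b powr - (real k * (\<delta> - \<epsilon> - 1))"
      using j(1) j_le[of j] by (intro exI[of _ "n j + l"]) auto
  qed
  have "\<Delta> (\<psi> t - v) = ereal \<delta>\<^sub>2" for t
  proof (rule antisym)
    \<comment> \<open>Blocks of both types respect \<open>\<delta>\<^sub>2\<close>, so the crude
      bound suffices here.\<close>
    show "\<Delta> (\<psi> t - v) \<le> ereal \<delta>\<^sub>2"
    proof (rule adic_exponent_leI)
      fix \<epsilon> :: real assume "\<epsilon> > 0"
      show "\<exists>c>0. \<exists>m N. \<forall>k\<ge>N. \<exists>k'\<in>{k..k + m}.
          c * real b powr - (real k' * (\<delta>\<^sub>2 + \<epsilon> - 1)) \<le> nd (real b ^ k' * (\<psi> t - v))"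
      proof (rule exI[of _ "real b powr - real l"], intro conjI exI[of _ l, OF exI[of _ 0]] allI impI)
        fix k
        obtain j k' where k': "k' \<in> {k..k + l}" "n j + l \<le> k'" "k' \<le> n (Suc j)" using window by blast
        have "real (n (Suc j)) \<le> \<delta>\<^sub>2 * real (n j + l)"
        proof (cases "B j")
          case False
          have "\<delta>\<^sub>1 * real (n j + l) \<le> \<delta>\<^sub>2 * real (n j + l)" using \<open>\<delta>\<^sub>1 < \<delta>\<^sub>2\<close> by (intro mult_right_mono) auto
          then show ?thesis using nB\<delta>[OF False] by linarith
        qed (rule B\<delta>)
        then have "real b powr - (real k' * (\<delta>\<^sub>2 + \<epsilon> - 1)) \<le> real b powr - (real (n (Suc j)) - real k')"
          using k' \<open>\<epsilon> > 0\<close> \<open>1 < \<delta>\<^sub>2\<close> by (intro block) auto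
        then have "real b powr - real l * real b powr - (real k' * (\<delta>\<^sub>2 + \<epsilon> - 1))
            \<le> real b powr - real l * real b powr - (real (n (Suc j)) - real k')"
          by (intro mult_left_mono) auto
        also have "\<dots> \<le> nd (real b ^ k' * (\<psi> t - v))" by (rule crude[OF k'(3) \<psi>v])
        finally show "\<exists>k'\<in>{k..k + l}. real b powr - real l * real b powr - (real k' * (\<delta>\<^sub>2 + \<epsilon> - 1))
            \<le> nd (real b ^ k' * (\<psi> t - v))" using k'(1) by blast
      qed (use real_b in simp)
    qed (use \<open>1 < \<delta>\<^sub>2\<close> in simp)
    show "ereal \<delta>\<^sub>2 \<le> \<Delta> (\<psi> t - v)"
    proof (intro adic_exponent_geI inf_block)
      fix \<epsilon> :: real and N assume "\<epsilon> > 0"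
      then obtain j where "j \<ge> N" "B j" "(\<delta>\<^sub>2 - \<epsilon>) * real (n j + l) \<le> real (n (Suc j))" using B_inf by blast
      then show "\<exists>j\<ge>N. nd (real b ^ (n j + l) * (\<psi> t - v)) \<le> real b powr - (real (n (Suc j)) - real (n j + l))
          \<and> (\<delta>\<^sub>2 - \<epsilon>) * real (n j + l) \<le> real (n (Suc j))"
        using \<psi>w[of j t] by (intro exI[of _ j]) (simp add: w_def)
    qed
  qed
  moreover have "\<Delta> (\<psi> t - u) = ereal \<delta>\<^sub>1" for t
  proof (rule antisym)
    show "\<Delta> (\<psi> t - u) \<le> ereal \<delta>\<^sub>1"
    proof (rule adic_exponent_leI[OF \<open>1 \<le> \<delta>\<^sub>1\<close>])
      fix \<epsilon> :: real assume "\<epsilon> > 0"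
      then have "\<Delta> (x\<^sub>0 - u) < ereal (\<delta>\<^sub>1 + \<epsilon>)" using u by simp
      then obtain N where N: "\<And>k. N \<le> k \<Longrightarrow>
          real b powr - (real k * (\<delta>\<^sub>1 + \<epsilon> - 1)) < nd (real b ^ k * (x\<^sub>0 - u))"
        by (rule adic_exponent_lessD) blast
      show "\<exists>c>0. \<exists>m N. \<forall>k\<ge>N. \<exists>k'\<in>{k..k + m}.
          c * real b powr - (real k' * (\<delta>\<^sub>1 + \<epsilon> - 1)) \<le> nd (real b ^ k' * (\<psi> t - u))"
      proof (rule exI[of _ "real b powr - real l / 4"], intro conjI exI[of _ l, OF exI[of _ N]] allI impI)
        fix k assume "N \<le> k"
        obtain j k' where k': "k' \<in> {k..k + l}" "n j + l \<le> k'" "k' \<le> n (Suc j)" using window by blast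
        define \<beta> where "\<beta> = real b powr - real l"
        define A where "A = real b powr - (real k' * (\<delta>\<^sub>1 + \<epsilon> - 1))"
        define Y where "Y = real b powr - (real (n (Suc j)) - real k')"
        have "0 < \<beta>" "\<beta> \<le> 1" "0 \<le> A" using real_b powr_mono[of "- real l" 0 "real b"] by (auto simp: \<beta>_def A_def)
        have \<beta>Y: "\<beta> * Y \<le> nd (real b ^ k' * (\<psi> t - u))"
          unfolding \<beta>_def Y_def by (rule crude[OF k'(3) \<psi>u])
        \<comment> \<open>\<open>A\<close> is the wanted size and \<open>Y\<close> the crude one.
          Only a block along \<open>v\<close> can make \<open>A > 4 * Y\<close>; there
          \<open>\<psi> t - u\<close> inherits the bound \<open>A\<close> from
          \<open>x\<^sub>0 - u\<close> with an error of at most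
          \<open>2 * Y < A / 2\<close>.\<close>
        have "\<beta> / 4 * A \<le> nd (real b ^ k' * (\<psi> t - u))"
        proof (cases "A \<le> 4 * Y")
          case True
          then have "\<beta> * (A / 4) \<le> \<beta> * Y" using \<open>0 < \<beta>\<close> by (intro mult_left_mono) auto
          then show ?thesis using \<beta>Y by simp
        next
          case False
          have "A \<le> Y" if "\<not> B j"
            unfolding A_def Y_def using nB\<delta>[OF that] k' \<open>\<epsilon> > 0\<close> \<open>1 \<le> \<delta>\<^sub>1\<close> by (intro block) auto
          then have "B j" using False \<open>0 \<le> A\<close> by linarith
          have shift: "nd (real b ^ k' * z) \<le> Y"
            if "nd (real b ^ (n j + l) * z) \<le> real b powr - (real (n (Suc j)) - real (n j + l))" for z
          proof -
            have "nd (real b ^ k' * z) \<le> real b powr (real k' - real (n j + l)) * nd (real b ^ (n j + l) * z)"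
              using k' by (intro nd_power_le)
            also have "\<dots> \<le> real b powr (real k' - real (n j + l)) * real b powr - (real (n (Suc j)) - real (n j + l))"
              using that by (intro mult_left_mono) auto
            also have "\<dots> = Y" unfolding Y_def powr_add[symmetric] by simp
            finally show ?thesis .
          qed
          have "nd (real b ^ k' * (\<psi> t - v)) \<le> Y" "nd (real b ^ k' * (x\<^sub>0 - v)) \<le> Y"
            using \<psi>w[of j t] Bx[OF \<open>B j\<close>] \<open>B j\<close> by (auto intro!: shift simp: w_def)
          moreover have "nd (real b ^ k' * (x\<^sub>0 - u)) \<le> nd (real b ^ k' * (\<psi> t - u))
              + nd (real b ^ k' * (\<psi> t - v) - real b ^ k' * (x\<^sub>0 - v))"
            using nd_diff[of "real b ^ k' * (\<psi> t - u)" "real b ^ k' * (\<psi> t - v) - real b ^ k' * (x\<^sub>0 - v)"]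
            by (simp add: algebra_simps)
          moreover have "A \<le> nd (real b ^ k' * (x\<^sub>0 - u))"
            unfolding A_def using N[of k'] k'(1) \<open>N \<le> k\<close> by (intro less_imp_le) auto
          ultimately have "A - 2 * Y \<le> nd (real b ^ k' * (\<psi> t - u))"
            using nd_diff[of "real b ^ k' * (\<psi> t - v)" "real b ^ k' * (x\<^sub>0 - v)"] by linarith
          moreover have "\<beta> / 4 * A \<le> 1 / 4 * A" using \<open>\<beta> \<le> 1\<close> \<open>0 \<le> A\<close> by (intro mult_right_mono) auto
          ultimately show ?thesis using False \<open>0 \<le> A\<close> by linarith
        qed
        then show "\<exists>k'\<in>{k..k + l}. real b powr - real l / 4 * real b powr - (real k' * (\<delta>\<^sub>1 + \<epsilon> - 1))
            \<le> nd (real b ^ k' * (\<psi> t - u))"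
          unfolding \<beta>_def A_def using k'(1) by blast
      qed (use real_b in simp)
    qed
    show "ereal \<delta>\<^sub>1 \<le> \<Delta> (\<psi> t - u)"
    proof (intro adic_exponent_geI inf_block)
      fix \<epsilon> :: real and N assume "\<epsilon> > 0"
      then obtain j where "j \<ge> N" "\<not> B j" "(\<delta>\<^sub>1 - \<epsilon>) * real (n j + l) \<le> real (n (Suc j))" using nB_inf by blast
      then show "\<exists>j\<ge>N. nd (real b ^ (n j + l) * (\<psi> t - u)) \<le> real b powr - (real (n (Suc j)) - real (n j + l))
          \<and> (\<delta>\<^sub>1 - \<epsilon>) * real (n j + l) \<le> real (n (Suc j))"
        using \<psi>w[of j t] by (intro exI[of _ j]) (simp add: w_def)
    qed
  qed
  moreover have "\<bar>t - t'\<bar> \<le> real b powr (s * real l) * dist (\<psi> t) (\<psi> t') powr s"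
    if t: "t \<in> {0..<1}" "t' \<in> {0..<1}" for t t'
  proof (cases "t = t'")
    case False
    then obtain j where j: "\<bar>t - t'\<bar> \<le> real b powr - real (L * j)" "real b powr - real (n j + l) \<le> \<bar>\<psi> t - \<psi> t'\<bar>"
      using sep[OF t] by blast
    \<comment> \<open>The density of free digits becomes the Hoelder exponent: \<open>L * j\<close>
      choices against a separation at level \<open>n j + l\<close>.\<close>
    have "s * real (n j) = \<sigma> * (\<kappa> * real (n j))" using \<sigma> by simp
    also have "\<dots> \<le> \<sigma> * (real l * real j)" using n\<kappa>[of j] \<sigma> by (intro mult_left_mono) auto
    also have "\<dots> \<le> real L * real j"
      using mult_right_mono[OF \<sigma>L, of "real j"] by (simp add: mult.assoc)
    finally have "real b powr - real (L * j) \<le> real b powr - (s * real (n j))"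
      using real_b by (intro powr_mono) auto
    also have "\<dots> = real b powr (s * real l) * (real b powr - real (n j + l)) powr s"
      unfolding powr_powr powr_add[symmetric] by (simp add: algebra_simps)
    also have "\<dots> \<le> real b powr (s * real l) * \<bar>\<psi> t - \<psi> t'\<bar> powr s"
      using j(2) \<open>0 \<le> s\<close> by (intro mult_left_mono powr_mono2) auto
    finally show ?thesis using j(1) by (simp add: dist_real_def)
  qed simp
  ultimately show ?thesis
    using \<open>0 \<le> s\<close> real_b
    by (intro hausdorff_measure_nonzero[where C = "real b powr (s * real l)" and \<psi> = \<psi>]) auto
qed

text \<open>Reciprocals let an infinite exponent appear as the value 0.\<close>

lemma hausdorff_dim_pair:
  fixes h\<^sub>1 h\<^sub>2 u v :: real
  assumes "0 \<le> h\<^sub>2" "h\<^sub>2 < h\<^sub>1" "h\<^sub>1 \<le> 1"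
  defines "E \<equiv> {x. 1 / \<Delta> (x - u) = ereal h\<^sub>1 \<and> 1 / \<Delta> (x - v) = ereal h\<^sub>2}"
  assumes "E \<noteq> {}"
  shows "hausdorff_dim E = ereal h\<^sub>2"
proof (rule antisym)
  have inv: "1 / \<Delta> z = ereal h \<longleftrightarrow> \<Delta> z = (if h = 0 then \<infinity> else ereal (1 / h))" if "0 \<le> h" for z h
    using adic_exponent_ge_1[of z] that
    by (cases "\<Delta> z") (auto simp: one_ereal_def field_simps)
  have E: "E = {x. \<Delta> (x - u) = ereal (1 / h\<^sub>1) \<and> \<Delta> (x - v) = (if h\<^sub>2 = 0 then \<infinity> else ereal (1 / h\<^sub>2))}"
    using assms by (simp add: inv)
  have dim: "hausdorff_dim E = Inf (ereal ` {s. s \<ge> 0 \<and> hausdorff_measure s E = 0})"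
    using \<open>E \<noteq> {}\<close> by (simp add: hausdorff_dim_def)
  show "hausdorff_dim E \<le> ereal h\<^sub>2"
  proof (rule dense_ge)
    fix e assume "ereal h\<^sub>2 < e"
    show "hausdorff_dim E \<le> e"
    proof (cases e)
      case (real s)
      then have "h\<^sub>2 < s" "0 < s" using \<open>ereal h\<^sub>2 < e\<close> assms by auto
      \<comment> \<open>\<open>d\<close> lies between \<open>1 / s\<close> and
        \<open>1 / h\<^sub>2\<close>. The reciprocal of the midpoint could drop below 1 for
        \<open>s > 1\<close>; there 1 itself works, since \<open>h\<^sub>2 < 1\<close>.\<close>
      obtain d where d: "1 \<le> d" "1 < s * d" "h\<^sub>2 * d < 1"
      proof (cases "s \<le> 1")
        case True
        have "1 / s < 1 / ((s + h\<^sub>2) / 2 ) "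
          using \<open>h\<^sub>2 < s\<close> assms by (intro divide_strict_left_mono) auto
        then show ?thesis
          using that[of "1 / ((s + h\<^sub>2) / 2)"] \<open>h\<^sub>2 < s\<close> True assms by (auto simp: field_simps)
      next
        case False
        then show ?thesis using that[of 1] assms by auto
      qed
      have "E \<subseteq> {x. ereal d < \<Delta> (x - v)}"
        using d(3) assms(1) unfolding E by (auto simp: field_simps split: if_splits)
      then have "hausdorff_measure s E \<le> hausdorff_measure s {x. ereal d < \<Delta> (x - v)}"
        unfolding hausdorff_measure_def by (intro SUP_mono') (rule hausdorff_premeasure_mono)
      then have "hausdorff_measure s E = 0"
        using hausdorff_measure_approximable[OF \<open>0 < s\<close> d(1,2)] by simp
      then show ?thesis unfolding dim real using \<open>0 < s\<close> by (intro Inf_lower) auto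
    qed (use \<open>ereal h\<^sub>2 < e\<close> in auto)
  qed
  show "ereal h\<^sub>2 \<le> hausdorff_dim E"
    unfolding dim
  proof (intro Inf_greatest, clarsimp)
    fix s :: real assume s: "0 \<le> s" "hausdorff_measure s E = 0"
    show "h\<^sub>2 \<le> s"
    proof (rule ccontr)
      assume "\<not> h\<^sub>2 \<le> s"
      \<comment> \<open>A nonnegative \<open>s\<close> below \<open>h\<^sub>2\<close> exists only
        for positive \<open>h\<^sub>2\<close>; hence both exponents are finite, as the Cantor
        construction requires.\<close>
      then have "0 < h\<^sub>2" "s * (1 / h\<^sub>2) < 1" using s(1) by (auto simp: field_simps)
      moreover obtain x\<^sub>0 where "x\<^sub>0 \<in> E" using \<open>E \<noteq> {}\<close> by blast
      moreover have "1 / h\<^sub>1 < 1 / h\<^sub>2" using \<open>0 < h\<^sub>2\<close> assms by (intro divide_strict_left_mono) auto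
      ultimately show False
        using hausdorff_measure_pair_nonzero[of x\<^sub>0 u "1 / h\<^sub>1" v "1 / h\<^sub>2" s] s unfolding E by auto
    qed
  qed
qed

end

section \<open>Translation invariance and conclusion\<close>

lemma holder_at_translate: "holder_at \<beta> (\<lambda>x. f (x - y)) x\<^sub>0 \<longleftrightarrow> holder_at \<beta> f (x\<^sub>0 - y)"
proof -
  have "(\<forall>x\<in>{x\<^sub>0 - r..x\<^sub>0 + r}. \<bar>f (x - y) - poly P (x - x\<^sub>0)\<bar> \<le> C * \<bar>x - x\<^sub>0\<bar> powr \<beta>) \<longleftrightarrow>
      (\<forall>x\<in>{x\<^sub>0 - y - r..x\<^sub>0 - y + r}. \<bar>f x - poly P (x - (x\<^sub>0 - y))\<bar> \<le> C * \<bar>x - (x\<^sub>0 - y)\<bar> powr \<beta>)"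
    (is "(\<forall>x\<in>?A. ?P x) \<longleftrightarrow> (\<forall>x\<in>?B. ?Q x)") for r P C
  proof -
    have "?B = (\<lambda>x. x - y) ` ?A"
      unfolding image_diff_atLeastAtMost[of y] by (simp add: algebra_simps)
    moreover have "x - y - (x\<^sub>0 - y) = x - x\<^sub>0" for x by simp
    ultimately show ?thesis by (simp only: ball_simps)
  qed
  then show ?thesis unfolding holder_at_def by (simp only:)
qed

lemma holder_exponent_translate: "holder_exponent (\<lambda>x. f (x - y)) x\<^sub>0 = holder_exponent f (x\<^sub>0 - y)"
  by (simp add: holder_exponent_def holder_at_translate)

theorem theorem2p5:
  fixes b :: nat and \<alpha>\<^sub>1 \<alpha>\<^sub>2 y H\<^sub>1 H\<^sub>2 :: real
  assumes "b \<ge> 2" and "\<alpha>\<^sub>1 > 0" and "\<alpha>\<^sub>2 > 0"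
    and "(H\<^sub>1, H\<^sub>2) \<in> ({0..\<alpha>\<^sub>1} \<times> {0..\<alpha>\<^sub>2}) - K_set b \<alpha>\<^sub>1 \<alpha>\<^sub>2 y"
  shows "bivariate_spectrum (levy \<alpha>\<^sub>1 b) (levy_translated \<alpha>\<^sub>2 b y) H\<^sub>1 H\<^sub>2
           = ereal (min (H\<^sub>1 / \<alpha>\<^sub>1) (H\<^sub>2 / \<alpha>\<^sub>2))
       \<or> bivariate_spectrum (levy \<alpha>\<^sub>1 b) (levy_translated \<alpha>\<^sub>2 b y) H\<^sub>1 H\<^sub>2 = - \<infinity>"
proof -
  interpret adic_base b using assms(1) by unfold_locales
  define h\<^sub>1 h\<^sub>2 where "h\<^sub>1 = H\<^sub>1 / \<alpha>\<^sub>1" and "h\<^sub>2 = H\<^sub>2 / \<alpha>\<^sub>2"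
  have h: "0 \<le> h\<^sub>1" "h\<^sub>1 \<le> 1" "0 \<le> h\<^sub>2" "h\<^sub>2 \<le> 1"
    using assms by (auto simp: h\<^sub>1_def h\<^sub>2_def)
  \<comment> \<open>After normalisation the excluded segment is the diagonal.\<close>
  have "h\<^sub>1 \<noteq> h\<^sub>2"
    using assms by (auto simp: h\<^sub>1_def h\<^sub>2_def K_set_def field_simps)
  define E where "E = {x. 1 / \<Delta> (x - 0) = ereal h\<^sub>1 \<and> 1 / \<Delta> (x - y) = ereal h\<^sub>2}"
  have div: "ereal \<alpha> / \<Delta> z = ereal H \<longleftrightarrow> 1 / \<Delta> z = ereal (H / \<alpha>)" if "\<alpha> > 0" for \<alpha> z H
    using adic_exponent_ge_1[of z] that by (cases "\<Delta> z") (auto simp: one_ereal_def field_simps)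
  have translated: "holder_exponent (levy_translated \<alpha>\<^sub>2 b y) x = ereal \<alpha>\<^sub>2 / \<Delta> (x - y)" for x
  proof -
    have "levy_translated \<alpha>\<^sub>2 b y = (\<lambda>x. levy \<alpha>\<^sub>2 b (x - y))"
      by (rule ext) (simp only: levy_translated_def levy_def)
    then show ?thesis
      by (simp only: holder_exponent_translate holder_exponent_levy[OF assms(3)])
  qed
  have spectrum: "bivariate_spectrum (levy \<alpha>\<^sub>1 b) (levy_translated \<alpha>\<^sub>2 b y) H\<^sub>1 H\<^sub>2 = hausdorff_dim E"
    unfolding bivariate_spectrum_def E_def
    using assms by (simp add: holder_exponent_levy translated div h\<^sub>1_def h\<^sub>2_def)
  show ?thesis
  proof (cases "E = {}")
    case True
    then show ?thesis using spectrum by (simp add: hausdorff_dim_def)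
  next
    case False
    show ?thesis
    proof (cases "h\<^sub>2 < h\<^sub>1")
      case True
      then have "hausdorff_dim E = ereal h\<^sub>2"
        using h False unfolding E_def by (intro hausdorff_dim_pair) auto
      then show ?thesis using spectrum True by (simp add: h\<^sub>1_def h\<^sub>2_def)
    next
      case less: False
      \<comment> \<open>The coordinate with the smaller normalised value has to come second, so the
        roles of the translates 0 and \<open>y\<close> are exchanged.\<close>
      have E': "E = {x. 1 / \<Delta> (x - y) = ereal h\<^sub>2 \<and> 1 / \<Delta> (x - 0) = ereal h\<^sub>1}"
        by (auto simp: E_def)
      have "hausdorff_dim E = ereal h\<^sub>1"
        using h False less \<open>h\<^sub>1 \<noteq> h\<^sub>2\<close> unfolding E' by (intro hausdorff_dim_pair) auto
      then show ?thesis using spectrum less by (simp add: h\<^sub>1_def h\<^sub>2_def)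
    qed
  qed
qed

end
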